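(* Let $\mathcal H$ be a real Hilbert space and let $f:\mathcal H\to\mathbb R\cup\{+\infty\}$ be proper, convex and lower semicontinuous with $\operatorname{argmin}_{\mathcal H}f\neq\emptyset$; write $f^*=\min_{\mathcal H} f$. Let $\alpha>3$, $\beta>0$, $t_0>0$, and let $\delta,\gamma:[t_0,+\infty)\to(0,+\infty)$ be $C^1$ functions such that: (a) $\liminf_{t\to+\infty}\frac{\dot\gamma(t)}{t\delta(t)}>0$; (b) $\frac{t\delta(t)}{\gamma(t)}=O(1/t)$ as $t\to+\infty$; (c) $\frac{\dot\gamma(t)}{\gamma(t)}=O(1/t)$ as $t\to+\infty$; (d) there exists $\zeta$ with $0<\zeta\le\alpha-3$ such that $0\le\frac{t\dot\delta(t)}{\delta(t)}\le\alpha-3-\zeta$ for all sufficiently large $t$. Let $x:[t_0,+\infty)\to\mathcal H$ be any solution trajectory of $$\ddot x(t)+\frac{\alpha}{t}\dot x(t)+\beta\,\frac{\mathrm d}{\mathrm dt}\Big[\delta(t)\nabla f_{\gamma(t)}(x(t))\Big]+\Big(1+\frac{\beta}{t}\Big)\delta(t)\nabla f_{\gamma(t)}(x(t))=0 .$$ Then, as $t\to+\infty$: (i) $f_{\gamma(t)}(x(t))-f^*=o\big(\frac{1}{t^2\delta(t)}\big)$; (ii) $\|\nabla f_{\gamma(t)}(x(t))\|=o\big(\frac{1}{t^2\delta(t)}\big)$; (iii) $\|\dot x(t)\|=o\big(\frac1t\big)$; (iv) $\int_{t_0}^{+\infty}t\|\dot x(t)\|^2\,\mathrm dt<+\infty$;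 (v) $\int_{t_0}^{+\infty}t^3\delta(t)^2\|\nabla f_{\gamma(t)}(x(t))\|^2\,\mathrm dt<+\infty$; (vi) if in addition $\liminf_{t\to+\infty}\frac{t^2\delta(t)}{\gamma(t)}>0$, then $x(t)$ converges weakly as $t\to+\infty$, and its limit belongs to $\operatorname{argmin}_{\mathcal H}f$.
   Context: For $\lambda>0$, $f_\lambda$ denotes the Moreau envelope $f_\lambda(x)=\min_{y\in\mathcal H}\{f(y)+\frac1{2\lambda}\|x-y\|^2\}$; it is convex and $C^1$, with $\frac1\lambda$-Lipschitz gradient $\nabla f_\lambda(x)=\frac1\lambda(x-\operatorname{prox}_{\lambda f}(x))$, where $\operatorname{prox}_{\lambda f}(x)$ is the unique minimizer in the definition of $f_\lambda(x)$. Solution convention: a solution trajectory is a $C^1$ function $x:[t_0,+\infty)\to\mathcal H$ with $\dot x$ locally absolutely continuous, satisfying the equation for almost every $t\ge t_0$. *)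

theory Defs
  imports "HOL-Analysis.Analysis"
begin

text \<open>A real Hilbert space is a type of sort \<open>{real_inner, banach}\<close>.\<close>

definition proper :: "('a \<Rightarrow> ereal) \<Rightarrow> bool" where
  "proper f \<longleftrightarrow> (\<forall>x. f x \<noteq> - \<infinity>) \<and> (\<exists>x. f x \<noteq> \<infinity>)"

text \<open>Convexity is restricted to \<open>0 < u < 1\<close>, so that no product of zero and infinity occurs.\<close>

definition convex_ereal :: "('a::real_vector \<Rightarrow> ereal) \<Rightarrow> bool" where
  "convex_ereal f \<longleftrightarrow>
     (\<forall>x y u. 0 < u \<and> u < 1 \<longrightarrow>
        f ((1 - u) *\<^sub>R x + u *\<^sub>R y) \<le> ereal (1 - u) * f x + ereal u * f y)"

definition lower_semicontinuous :: "('a::topological_space \<Rightarrow> ereal) \<Rightarrow> bool" where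
  "lower_semicontinuous f \<longleftrightarrow> (\<forall>x. f x \<le> Liminf (nhds x) f)"

definition argmin :: "('a \<Rightarrow> ereal) \<Rightarrow> 'a set" where
  "argmin f = {x. is_arg_min f (\<lambda>_. True) x}"

text \<open>
  The infimum is taken in the extended reals. For a proper \<open>f\<close> with a minimizer and
  for \<open>l > 0\<close> it is a real number, so that \<open>real_of_ereal\<close> loses nothing.
\<close>

definition moreau_envelope :: "('a::real_inner \<Rightarrow> ereal) \<Rightarrow> real \<Rightarrow> 'a \<Rightarrow> real" where
  "moreau_envelope f l x =
     real_of_ereal (INF y. f y + ereal (1 / (2 * l) * (norm (x - y))\<^sup>2))"

definition min_value :: "('a \<Rightarrow> ereal) \<Rightarrow> real" where
  "min_value f = real_of_ereal (INF y. f y)"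

definition gradient :: "('a::real_inner \<Rightarrow> real) \<Rightarrow> 'a \<Rightarrow> 'a" where
  "gradient g x = (THE D. GDERIV g x :> D)"

lemma gradient_eqI:
  assumes "GDERIV g x :> D"
  shows "gradient g x = D"
proof -
  have "D' = D" if "GDERIV g x :> D'" for D'
  proof -
    have "(\<lambda>h. inner h D') = (\<lambda>h. inner h D)"
      using that assms unfolding gderiv_def by (rule has_derivative_unique)
    then have "inner (D' - D) D' = inner (D' - D) D"
      by (rule fun_cong)
    then have "inner (D' - D) (D' - D) = 0"
      by (simp add: inner_diff_right)
    then show ?thesis
      by simp
  qed
  with assms show ?thesis
    unfolding gradient_def by (rule the_equality)
qed

text \<open>
  \<open>C1_from t0 g g'\<close>: the restriction of \<open>g\<close> to \<open>[t0, \<infinity>)\<close> is of class \<open>C\<^sup>1\<close> with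
  derivative \<open>g'\<close> (one-sided at \<open>t0\<close>).
\<close>

definition C1_from :: "real \<Rightarrow> (real \<Rightarrow> 'a::real_normed_vector) \<Rightarrow> (real \<Rightarrow> 'a) \<Rightarrow> bool" where
  "C1_from t0 g g' \<longleftrightarrow>
     (\<forall>t\<ge>t0. (g has_vector_derivative g' t) (at t within {t0..})) \<and> continuous_on {t0..} g'"

definition abs_continuous_on_interval ::
  "real \<Rightarrow> real \<Rightarrow> (real \<Rightarrow> 'a::real_normed_vector) \<Rightarrow> bool" where
  "abs_continuous_on_interval a b g \<longleftrightarrow>
     (\<forall>\<epsilon>>0. \<exists>\<eta>>0. \<forall>(n::nat) l r.
        (\<forall>i<n. a \<le> l i \<and> l i \<le> r i \<and> r i \<le> b) \<and>
        disjoint_family_on (\<lambda>i. {l i<..<r i}) {..<n} \<and>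
        (\<Sum>i<n. r i - l i) < \<eta>
        \<longrightarrow> (\<Sum>i<n. norm (g (r i) - g (l i))) < \<epsilon>)"

definition locally_abs_continuous_from :: "real \<Rightarrow> (real \<Rightarrow> 'a::real_normed_vector) \<Rightarrow> bool" where
  "locally_abs_continuous_from t0 g \<longleftrightarrow> (\<forall>T\<ge>t0. abs_continuous_on_interval t0 T g)"

text \<open>
  \<open>x'\<close> is the derivative of \<open>x\<close>. At almost every \<open>t\<close>, \<open>x''\<close> is the second derivative
  of \<open>x\<close> and \<open>w\<close> is the derivative of \<open>s \<mapsto> \<delta>(s) \<nabla>f\<^bsub>\<gamma>(s)\<^esub>(x(s))\<close>.
\<close>

definition solution_trajectory ::
  "('a::{real_inner, banach} \<Rightarrow> ereal) \<Rightarrow> real \<Rightarrow> real \<Rightarrow> (real \<Rightarrow> real) \<Rightarrow> (real \<Rightarrow> real) \<Rightarrow> real \<Rightarrow>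
   (real \<Rightarrow> 'a) \<Rightarrow> (real \<Rightarrow> 'a) \<Rightarrow> bool" where
  "solution_trajectory f \<alpha> \<beta> \<delta> \<gamma> t0 x x' \<longleftrightarrow>
     C1_from t0 x x' \<and> locally_abs_continuous_from t0 x' \<and>
     (AE t in lborel. t \<ge> t0 \<longrightarrow>
        (\<exists>x'' w.
           (x' has_vector_derivative x'') (at t within {t0..}) \<and>
           ((\<lambda>s. \<delta> s *\<^sub>R gradient (moreau_envelope f (\<gamma> s)) (x s)) has_vector_derivative w)
             (at t within {t0..}) \<and>
           x'' + (\<alpha> / t) *\<^sub>R x' t + \<beta> *\<^sub>R w
             + ((1 + \<beta> / t) * \<delta> t) *\<^sub>R gradient (moreau_envelope f (\<gamma> t)) (x t) = 0))"

definition weakly_tendsto :: "('b \<Rightarrow> 'a::real_inner) \<Rightarrow> 'a \<Rightarrow> 'b filter \<Rightarrow> bool" where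
  "weakly_tendsto x z F \<longleftrightarrow> (\<forall>y. ((\<lambda>t. inner (x t) y) \<longlongrightarrow> inner z y) F)"

end

theory Submission
  imports Defs
begin

text \<open>
  Write \<open>g\<close> for the gradient of the envelope along the trajectory. The damping coefficients are such
  that \<open>p = x' + \<beta> \<delta> g\<close> satisfies \<open>(t p)' = (1 - \<alpha>) x' - t \<delta> g\<close>. For a minimizer \<open>z\<close>, a small
  \<open>k > 0\<close>, and \<open>\<phi>\<close> the gap between the envelope along the trajectory and the minimum, consider
  \<open>|(\<alpha> - 1 - k) (x - z) + t p|\<^sup>2 / 2 + (\<alpha> - 1 - k) k |x - z|\<^sup>2 / 2 + (t\<^sup>2 + \<beta> k t) \<delta> \<phi>\<close>.
  Its derivative is at most a negative multiple of \<open>t \<delta> \<phi> + t |x'|\<^sup>2 + t\<^sup>3 \<delta>\<^sup>2 |g|\<^sup>2\<close>, which gives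
  boundedness and the integral estimates. This energy has a limit for every small \<open>k\<close>; comparing two
  values of \<open>k\<close> shows that \<open>h = t\<^sup>2 |p|\<^sup>2 / 2 + t\<^sup>2 \<delta> \<phi>\<close> has a limit. Since \<open>h / t\<close> is dominated by
  the dissipation and \<open>1 / t\<close> is not integrable, that limit is zero. The pointwise rates follow, and with them
  the convergence of \<open>|x - z|\<close> needed for Opial's argument.
\<close>

subsection \<open>The fundamental theorem of calculus for absolutely continuous functions\<close>

text \<open>The obstacle is regularity: the equation holds only almost everywhere and
  \<open>x'\<close> is only absolutely continuous, so a Lyapunov function built on \<open>x'\<close>
  is not known to be differentiable at every time. Integrating the equation once repairs this,
  because \<open>p\<close> is then the integral of a continuous function; this is what the
  fundamental theorem for Banach-valued functions is for. The parameter \<open>k\<close> balances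
  two needs. The velocity is dissipated with coefficient \<open>k t\<close>, which forces
  \<open>k > 0\<close>; the gap has a negative leading coefficient only for
  \<open>k < \<zeta>\<close>, where \<open>\<zeta>\<close> is the slack in hypothesis (d).
  Hypothesis (a) makes the decrease of the envelope in its parameter pay for the cubic weight on the
  gradient, and (b) converts the rate of the gap into the rate of the gradient.\<close>

lemma abs_continuous_sum_less:
  fixes u :: "real \<Rightarrow> 'a::real_normed_vector"
  assumes ac: "\<forall>(n::nat) l r. (\<forall>i<n. a \<le> l i \<and> l i \<le> r i \<and> r i \<le> b) \<and>
        disjoint_family_on (\<lambda>i. {l i<..<r i}) {..<n} \<and> (\<Sum>i<n. r i - l i) < \<eta>
        \<longrightarrow> (\<Sum>i<n. norm (u (r i) - u (l i))) < \<epsilon>"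
    and tag: "q tagged_partial_division_of {a..b}"
    and len: "(\<Sum>(x,K)\<in>q. Sup K - Inf K) < \<eta>"
  shows "(\<Sum>(x,K)\<in>q. norm (u (Sup K) - u (Inf K))) < \<epsilon>"
proof -
  have "finite q" using tag by (auto simp: tagged_partial_division_of_def)
  \<comment> \<open>Absolute continuity is stated for families indexed by natural numbers, so the
    tagged pairs are enumerated; distinct pairs have disjoint interiors.\<close>
  then obtain h where h: "bij_betw h {0..<card q} q"
    using ex_bij_betw_nat_finite by blast
  then have h': "bij_betw h {..<card q} q" by (simp add: lessThan_atLeast0)
  define l where "l i = Inf (snd (h i))" for i
  define r where "r i = Sup (snd (h i))" for i
  have mem: "h i \<in> q" if "i < card q" for i
    using h' that by (auto simp: bij_betw_def)
  have K: "\<exists>c d. snd (h i) = {c..d} \<and> a \<le> c \<and> c \<le> d \<and> d \<le> b" if "i < card q" for i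
  proof -
    obtain x K where xK: "h i = (x, K)" "(x, K) \<in> q" using mem[OF \<open>i < card q\<close>] by (cases "h i") auto
    then obtain c d where "K = {c..d}" "x \<in> K" "K \<subseteq> {a..b}"
      using tag unfolding tagged_partial_division_of_def by (metis box_real(2))
    then show ?thesis using xK by auto
  qed
  have K': "snd (h i) = {l i..r i}" "a \<le> l i" "l i \<le> r i" "r i \<le> b" if "i < card q" for i
  proof -
    obtain c d where "snd (h i) = {c..d}" "a \<le> c" "c \<le> d" "d \<le> b"
      using K[OF \<open>i < card q\<close>] by blast
    then show "snd (h i) = {l i..r i}" "a \<le> l i" "l i \<le> r i" "r i \<le> b"
      by (simp_all add: l_def r_def)
  qed
  have "disjoint_family_on (\<lambda>i. {l i<..<r i}) {..<card q}"
    unfolding disjoint_family_on_def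
  proof (intro ballI impI)
    fix i j assume ij: "i \<in> {..<card q}" "j \<in> {..<card q}" "i \<noteq> j"
    then have "h i \<noteq> h j" using h' by (auto simp: bij_betw_def inj_on_def)
    then have "interior (snd (h i)) \<inter> interior (snd (h j)) = {}"
      using tag mem[of i] mem[of j] ij unfolding tagged_partial_division_of_def
      by (metis lessThan_iff prod.collapse)
    then show "{l i<..<r i} \<inter> {l j<..<r j} = {}"
      using K'(1)[of i] K'(1)[of j] ij by (simp add: interior_atLeastAtMost_real)
  qed
  moreover have "(\<Sum>i<card q. r i - l i) = (\<Sum>(x,K)\<in>q. Sup K - Inf K)"
    using sum.reindex_bij_betw[OF h', of "\<lambda>(x,K). Sup K - Inf K"]
    by (simp add: l_def r_def case_prod_beta)
  moreover have "(\<Sum>i<card q. norm (u (r i) - u (l i))) = (\<Sum>(x,K)\<in>q. norm (u (Sup K) - u (Inf K)))"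
    using sum.reindex_bij_betw[OF h', of "\<lambda>(x,K). norm (u (Sup K) - u (Inf K))"]
    by (simp add: l_def r_def case_prod_beta)
  ultimately show ?thesis
    using ac[THEN spec[of _ "card q"], THEN spec[of _ l], THEN spec[of _ r]] K' len by simp
qed

text \<open>The interiors of the intervals are disjoint open subsets of \<open>U\<close>, and
  passing to interiors costs no length. This bounds the total length of the intervals whose tags lie
  in the exceptional null set.\<close>

lemma tagged_partial_division_length_le:
  assumes tag: "q tagged_partial_division_of {a..b::real}" and sub: "\<And>x K. (x,K) \<in> q \<Longrightarrow> K \<subseteq> U"
    and U: "open U" and le: "emeasure lebesgue U \<le> ennreal e" and "e \<ge> 0"
  shows "(\<Sum>(x,K)\<in>q. Sup K - Inf K) \<le> e"
proof -
  have fin: "finite q" using tag by (auto simp: tagged_partial_division_of_def)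
  have K: "\<exists>c d. K = {c..d} \<and> c \<le> d" if "(x,K) \<in> q" for x K
    using tag that unfolding tagged_partial_division_of_def
    by (metis atLeastAtMost_iff box_real(2) order_trans)
  let ?I = "\<lambda>p. interior (snd p)"
  have dis: "disjoint_family_on ?I q"
    using tag unfolding disjoint_family_on_def tagged_partial_division_of_def by (metis prod.collapse)
  have m: "emeasure lborel (?I p) = ennreal (Sup (snd p) - Inf (snd p))" if "p \<in> q" for p
    using K[of "fst p" "snd p"] that by (auto simp: interior_atLeastAtMost_real)
  have nn: "0 \<le> Sup (snd p) - Inf (snd p)" if "p \<in> q" for p
    using K[of "fst p" "snd p"] that by auto
  have "ennreal (\<Sum>p\<in>q. Sup (snd p) - Inf (snd p)) = (\<Sum>p\<in>q. emeasure lborel (?I p))"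
    using m nn by (simp flip: sum_ennreal)
  also have "\<dots> = emeasure lborel (\<Union>p\<in>q. ?I p)"
    by (rule sum_emeasure) (use fin dis in auto)
  also have "\<dots> \<le> emeasure lborel U"
    using sub interior_subset U by (intro emeasure_mono) fastforce+
  also have "\<dots> \<le> ennreal e" using le U by simp
  finally show ?thesis using \<open>e \<ge> 0\<close> by (simp add: case_prod_beta)
qed

text \<open>The exceptional null set is covered by an open set of small measure; absolute continuity
  controls the part of a tagged division whose tags lie in it.\<close>

theorem fundamental_theorem_of_calculus_abs_continuous:
  fixes u :: "real \<Rightarrow> 'a::banach"
  assumes "a \<le> b" and ac: "abs_continuous_on_interval a b u"
    and deriv: "AE t in lborel. t \<in> {a..b} \<longrightarrow> (u has_vector_derivative k t) (at t within {a..b})"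
  shows "(k has_integral (u b - u a)) {a..b}"
proof -
  define N where "N = {t \<in> {a..b}. \<not> (u has_vector_derivative k t) (at t within {a..b})}"
  have "negligible N"
  proof -
    obtain M where "{t \<in> space lborel. \<not> (t \<in> {a..b} \<longrightarrow> (u has_vector_derivative k t) (at t within {a..b}))} \<subseteq> M"
      and M: "emeasure lborel M = 0" "M \<in> sets lborel"
      using deriv by (rule AE_E)
    then have "N \<subseteq> M" by (auto simp: N_def)
    moreover have "M \<in> null_sets lebesgue"
      using M by (intro null_sets_completionI null_setsI)
    ultimately have "N \<in> null_sets lebesgue"
      using null_sets_completion_subset by blast
    then show ?thesis by (simp add: negligible_iff_null_sets)
  qed
  \<comment> \<open>With the value 0 on \<open>N\<close>, tags in \<open>N\<close> contribute
    nothing to the Riemann sum, and only the increments of \<open>u\<close> over their intervals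
    remain to be estimated.\<close>
  define k0 where "k0 t = (if t \<in> N then 0 else k t)" for t
  have "(k0 has_integral (u b - u a)) {a..b}"
    unfolding has_integral_real
  proof (intro allI impI)
    fix e :: real assume "e > 0"
    \<comment> \<open>Slope tolerance at the good tags: the errors add up to at most
      \<open>e1 * (b - a)\<close>. The added 1 keeps the denominator positive when
      \<open>a = b\<close>.\<close>
    define e1 where "e1 = e / 2 / (b - a + 1)"
    have e1: "e1 > 0" "e1 * (b - a) < e / 2"
      using \<open>e > 0\<close> \<open>a \<le> b\<close> by (auto simp: e1_def field_simps)
    obtain \<eta> where "\<eta> > 0" and \<eta>: "\<forall>(n::nat) l r. (\<forall>i<n. a \<le> l i \<and> l i \<le> r i \<and> r i \<le> b) \<and>
        disjoint_family_on (\<lambda>i. {l i<..<r i}) {..<n} \<and> (\<Sum>i<n. r i - l i) < \<eta>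
        \<longrightarrow> (\<Sum>i<n. norm (u (r i) - u (l i))) < e / 2"
      using ac[unfolded abs_continuous_on_interval_def, THEN spec, THEN mp, OF half_gt_zero[OF \<open>e > 0\<close>]]
      by (elim exE conjE) (rule that)
    have "N \<in> sets lebesgue" "emeasure lebesgue N = 0"
      using \<open>negligible N\<close> by (auto simp: negligible_iff_null_sets)
    obtain U where U: "open U" "N \<subseteq> U" "U - N \<in> lmeasurable" "emeasure lebesgue (U - N) < ennreal (\<eta> / 2)"
      using sets_lebesgue_outer_open[OF \<open>N \<in> sets lebesgue\<close>, of "\<eta>/2"] \<open>\<eta> > 0\<close> by auto
    have "emeasure lebesgue U = emeasure lebesgue (N \<union> (U - N))"
      using U(2) by (simp add: Un_absorb1)
    also have "\<dots> \<le> emeasure lebesgue N + emeasure lebesgue (U - N)"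
      using U \<open>N \<in> sets lebesgue\<close> by (intro emeasure_subadditive) (auto simp: fmeasurable_def)
    finally have Um: "emeasure lebesgue U \<le> ennreal (\<eta> / 2)"
      using U(4) \<open>emeasure lebesgue N = 0\<close> by simp
    have "\<exists>d>0. t \<in> {a..b} - N \<longrightarrow>
         (\<forall>y\<in>{a..b}. norm (y-t) < d \<longrightarrow> norm (u y - u t - (y-t) *\<^sub>R k t) \<le> e1 * norm (y-t))" for t
    proof (cases "t \<in> {a..b} - N")
      case True
      then have "(u has_vector_derivative k t) (at t within {a..b})" by (auto simp: N_def)
      then show ?thesis
        using e1(1) unfolding has_vector_derivative_def has_derivative_within_alt by blast
    qed (auto intro: exI[of _ 1])
    then obtain d where d: "\<And>t. 0 < d t"
      "\<And>t y. \<lbrakk>t \<in> {a..b} - N; y \<in> {a..b}; norm (y-t) < d t\<rbrakk>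
         \<Longrightarrow> norm (u y - u t - (y-t) *\<^sub>R k t) \<le> e1 * norm (y-t)"
      by metis
    \<comment> \<open>A fine interval tagged in \<open>N\<close> lies inside \<open>U\<close>, whose
      measure is at most \<open>\<eta> / 2\<close>; at any other tag the ball is one in which
      \<open>u\<close> is nearly linear.\<close>
    define \<Gamma> where "\<Gamma> t = (if t \<in> N then U else ball t (d t))" for t
    have "gauge \<Gamma>"
      using U(1,2) d(1) by (auto simp: gauge_def \<Gamma>_def)
    moreover have "norm ((\<Sum>(x,K)\<in>p. measure lborel K *\<^sub>R k0 x) - (u b - u a)) < e"
      if p: "p tagged_division_of {a..b}" and fine: "\<Gamma> fine p" for p
    proof -
      have fin: "finite p" using p by auto
      have ba: "b - a = (\<Sum>(x,K)\<in>p. Sup K - Inf K)" "u b - u a = (\<Sum>(x,K)\<in>p. u (Sup K) - u (Inf K))"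
        using additive_tagged_division_1[where f= "\<lambda>x. x"] additive_tagged_division_1[where f= u]
            \<open>a \<le> b\<close> p by auto
      define q where "q = {(x,K) \<in> p. x \<in> N}"
      have qp: "q \<subseteq> p" by (auto simp: q_def)
      let ?S = "\<lambda>(x,K). measure lborel K *\<^sub>R k0 x - (u (Sup K) - u (Inf K))"
      have K: "\<exists>c v. K = {c..v} \<and> a \<le> c \<and> c \<le> x \<and> x \<le> v \<and> v \<le> b" if "(x,K) \<in> p" for x K
      proof -
        from tagged_division_ofD(2,3,4)[OF p \<open>(x,K) \<in> p\<close>] obtain c v where "K = cbox c v" "x \<in> K" "K \<subseteq> {a..b}"
          by blast
        then show ?thesis by auto
      qed
      have "norm (sum ?S q) \<le> (\<Sum>(x,K)\<in>q. norm (u (Sup K) - u (Inf K)))"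
        by (rule sum_norm_le) (auto simp: q_def k0_def norm_minus_commute)
      also have "\<dots> < e / 2"
      proof (rule abs_continuous_sum_less[OF \<eta>])
        show q: "q tagged_partial_division_of {a..b}"
          using p by (intro tagged_partial_division_subset[OF _ qp]) (simp add: tagged_division_of_def)
        have "(\<Sum>(x,K)\<in>q. Sup K - Inf K) \<le> \<eta> / 2"
        proof (rule tagged_partial_division_length_le[OF q _ U(1) Um])
          fix x K assume "(x,K) \<in> q"
          then show "K \<subseteq> U"
            using fineD[OF fine, of x K] by (auto simp: q_def \<Gamma>_def)
        qed (use \<open>\<eta> > 0\<close> in simp)
        then show "(\<Sum>(x,K)\<in>q. Sup K - Inf K) < \<eta>"
          using \<open>\<eta> > 0\<close> by linarith
      qed
      finally have 1: "norm (sum ?S q) < e / 2" .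
      have "norm (sum ?S (p - q)) \<le> (\<Sum>(x,K)\<in>p - q. e1 * (Sup K - Inf K))"
      proof (rule sum_norm_le, safe)
        fix x K assume xK: "(x,K) \<in> p" "(x,K) \<notin> q"
        then have "x \<notin> N" by (auto simp: q_def)
        obtain c v where cv: "K = {c..v}" "a \<le> c" "c \<le> x" "x \<le> v" "v \<le> b" using K[OF xK(1)] by blast
        have "K \<subseteq> ball x (d x)" using fineD[OF fine xK(1)] \<open>x \<notin> N\<close> by (auto simp: \<Gamma>_def)
        moreover have "c \<in> K" "v \<in> K" using cv by auto
        ultimately have "c \<in> ball x (d x)" "v \<in> ball x (d x)" by blast+
        then have "norm (c - x) < d x" "norm (v - x) < d x"
          by (simp_all add: dist_norm norm_minus_commute)
        then have "norm (u c - u x - (c-x) *\<^sub>R k x) \<le> e1 * norm (c-x)"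
            "norm (u v - u x - (v-x) *\<^sub>R k x) \<le> e1 * norm (v-x)"
          using cv \<open>x \<notin> N\<close> by (auto intro!: d(2) simp del: real_norm_def)
        \<comment> \<open>The linear estimate is relative to the tag, so the increment is split
          there; as the tag lies between \<open>c\<close> and \<open>v\<close>, the two errors sum
          to \<open>e1 * (v - c)\<close>.\<close>
        moreover have "(v - c) *\<^sub>R k x - (u v - u c) =
            (u c - u x - (c-x) *\<^sub>R k x) - (u v - u x - (v-x) *\<^sub>R k x)"
          by (simp add: algebra_simps)
        ultimately have "norm ((v - c) *\<^sub>R k x - (u v - u c)) \<le> e1 * norm (c-x) + e1 * norm (v-x)"
          using norm_triangle_ineq4 by (smt (verit, best))
        also have "\<dots> = e1 * (v - c)"
          using cv by (simp add: algebra_simps)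
        finally show "norm (measure lborel K *\<^sub>R k0 x - (u (Sup K) - u (Inf K))) \<le> e1 * (Sup K - Inf K)"
          using cv \<open>x \<notin> N\<close> by (simp add: k0_def)
      qed
      also have "\<dots> \<le> (\<Sum>(x,K)\<in>p. e1 * (Sup K - Inf K))"
        using K e1(1) by (intro sum_mono2 fin) force+
      also have "\<dots> = e1 * (b - a)"
        by (simp add: ba(1) sum_distrib_left case_prod_beta)
      also have "\<dots> < e / 2" by (rule e1)
      finally have 2: "norm (sum ?S (p - q)) < e / 2" .
      have "(\<Sum>(x,K)\<in>p. measure lborel K *\<^sub>R k0 x) - (u b - u a) = sum ?S p"
        by (simp add: ba(2) sum_subtractf case_prod_beta)
      also have "\<dots> = sum ?S (p - q) + sum ?S q"
        using sum.subset_diff[OF qp fin] .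
      finally show ?thesis
        using 1 2 norm_triangle_ineq[of "sum ?S (p - q)" "sum ?S q"] by simp
    qed
    ultimately show "\<exists>\<gamma>. gauge \<gamma> \<and> (\<forall>p. p tagged_division_of {a..b} \<and> \<gamma> fine p \<longrightarrow>
        norm ((\<Sum>(x,K)\<in>p. measure lborel K *\<^sub>R k0 x) - (u b - u a)) < e)"
      by (intro exI[of _ \<Gamma>]) simp
  qed
  then show ?thesis
    by (rule has_integral_spike[OF \<open>negligible N\<close>, rotated]) (auto simp: k0_def)
qed

text \<open>A Lipschitz perturbation does not destroy absolute continuity. The intended case is
  \<open>g = x'\<close> and \<open>h = p\<close>, which differ by a Lipschitz gradient term.\<close>

lemma abs_continuous_on_interval_dominated:
  fixes g :: "real \<Rightarrow> 'a::real_normed_vector" and h :: "real \<Rightarrow> 'b::real_normed_vector"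
  assumes ac: "abs_continuous_on_interval a b g"
    and le: "\<And>s t. \<lbrakk>a \<le> s; s \<le> t; t \<le> b\<rbrakk> \<Longrightarrow> norm (h t - h s) \<le> norm (g t - g s) + L * (t - s)"
  shows "abs_continuous_on_interval a b h"
  unfolding abs_continuous_on_interval_def
proof (intro allI impI)
  fix e :: real assume e0: "e > 0"
  obtain \<eta> where "\<eta> > 0" and \<eta>: "\<forall>(n::nat) l r. (\<forall>i<n. a \<le> l i \<and> l i \<le> r i \<and> r i \<le> b) \<and>
        disjoint_family_on (\<lambda>i. {l i<..<r i}) {..<n} \<and> (\<Sum>i<n. r i - l i) < \<eta>
        \<longrightarrow> (\<Sum>i<n. norm (g (r i) - g (l i))) < e / 2"
    using ac[unfolded abs_continuous_on_interval_def, THEN spec, THEN mp, OF half_gt_zero[OF e0]]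
    by (elim exE conjE) (rule that)
  \<comment> \<open>\<open>L\<close> carries no sign condition; \<open>\<bar>L\<bar> + 1\<close> is
    a positive upper bound for it.\<close>
  define \<eta>' where "\<eta>' = min \<eta> (e / 2 / (\<bar>L\<bar> + 1))"
  have "\<eta>' > 0" using \<open>e > 0\<close> \<open>\<eta> > 0\<close> by (simp add: \<eta>'_def)
  moreover have "(\<Sum>i<n. norm (h (r i) - h (l i))) < e"
    if *: "\<forall>i<n. a \<le> l i \<and> l i \<le> r i \<and> r i \<le> b"
      and "disjoint_family_on (\<lambda>i. {l i<..<r i}) {..<n}" and len: "(\<Sum>i<n. r i - l i) < \<eta>'"
    for n :: nat and l r
  proof -
    have "(\<Sum>i<n. norm (h (r i) - h (l i))) \<le> (\<Sum>i<n. norm (g (r i) - g (l i)) + L * (r i - l i))"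
      using * le by (intro sum_mono) auto
    also have "\<dots> = (\<Sum>i<n. norm (g (r i) - g (l i))) + L * (\<Sum>i<n. r i - l i)"
      by (simp add: sum.distrib sum_distrib_left)
    also have "(\<Sum>i<n. norm (g (r i) - g (l i))) < e / 2"
      using \<eta> that by (auto simp: \<eta>'_def)
    also have "L * (\<Sum>i<n. r i - l i) \<le> (\<bar>L\<bar> + 1) * (\<Sum>i<n. r i - l i)"
      using * by (intro mult_right_mono sum_nonneg) auto
    also have "\<dots> \<le> (\<bar>L\<bar> + 1) * (e / 2 / (\<bar>L\<bar> + 1))"
      using len by (intro mult_left_mono) (auto simp: \<eta>'_def)
    also have "\<dots> = e / 2"
      by (simp add: field_simps add_nonneg_eq_0_iff)
    finally show ?thesis by simp
  qed
  ultimately show "\<exists>\<eta>>0. \<forall>(n::nat) l r. (\<forall>i<n. a \<le> l i \<and> l i \<le> r i \<and> r i \<le> b) \<and>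
        disjoint_family_on (\<lambda>i. {l i<..<r i}) {..<n} \<and> (\<Sum>i<n. r i - l i) < \<eta>
        \<longrightarrow> (\<Sum>i<n. norm (h (r i) - h (l i))) < e"
    by blast
qed

subsection \<open>Moreau envelopes in Hilbert space\<close>

lemma parallelogram_midpoint:
  fixes a b :: "'a::real_inner"
  shows "(norm (a - b))\<^sup>2 = 2 * (norm a)\<^sup>2 + 2 * (norm b)\<^sup>2 - 4 * (norm (midpoint a b))\<^sup>2"
  unfolding power2_norm_eq_inner midpoint_def
  by (simp add: inner_add_left inner_add_right inner_diff_left inner_diff_right inner_commute[of b a] algebra_simps)

text \<open>Almost minimal-norm points of the sets form a Cauchy sequence: the infima of the squared
  norm increase and are bounded, and the parallelogram law turns their differences into distances.
  This form of weak compactness serves both the existence of proximal points and the cluster points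
  in Opial's argument.\<close>

lemma decreasing_closed_convex_Inter_nonempty:
  fixes C :: "nat \<Rightarrow> 'a::{real_inner, banach} set"
  assumes closed: "\<And>n. closed (C n)" and convex: "\<And>n. convex (C n)"
    and ne: "\<And>n. C n \<noteq> {}" and dec: "decseq C" and bnd: "bounded (C 0)"
  shows "(\<Inter>n. C n) \<noteq> {}"
proof -
  define m where "m n = (INF y\<in>C n. (norm y)\<^sup>2)" for n
  have bb: "bdd_below ((\<lambda>y. (norm y)\<^sup>2) ` C n)" for n
    by (rule bdd_belowI2[where m=0]) simp
  have m_le: "m n \<le> (norm y)\<^sup>2" if "y \<in> C n" for n y
    unfolding m_def using cINF_lower[OF bb that] .
  have sub: "C j \<subseteq> C i" if "i \<le> j" for i j
    using dec that by (simp add: decseq_def)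
  have "\<exists>y\<in>C n. (norm y)\<^sup>2 < m n + 1 / real (Suc n)" for n
    using cINF_less_iff[OF ne bb, of n "m n + 1 / real (Suc n)"] by (simp add: m_def)
  then obtain p where p: "\<And>n. p n \<in> C n" "\<And>n. (norm (p n))\<^sup>2 < m n + 1 / real (Suc n)"
    by metis
  have m_mono: "m i \<le> m j" if "i \<le> j" for i j
    unfolding m_def by (rule cINF_superset_mono[OF ne bb sub[OF that]]) simp
  obtain B where B: "\<And>y. y \<in> C 0 \<Longrightarrow> norm y \<le> B"
    using bnd by (auto simp: bounded_iff)
  have "m n \<le> B\<^sup>2" for n
  proof -
    have "p n \<in> C 0" using p(1) sub by blast
    then have "(norm (p n))\<^sup>2 \<le> B\<^sup>2"
      using B by (intro power_mono) auto
    with m_le[OF p(1)] show ?thesis by (rule order_trans)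
  qed
  then obtain L where "m \<longlonglongrightarrow> L"
    using incseq_convergent[of m "B\<^sup>2"] m_mono by (metis incseq_def)
  then have "Cauchy m" by (rule LIMSEQ_imp_Cauchy)
  have dist2: "(dist (p i) (p j))\<^sup>2 \<le> 2 * \<bar>m j - m i\<bar> + 4 / real (Suc i)" if "i \<le> j" for i j
  proof -
    \<comment> \<open>The midpoint stays in the larger set \<open>C i\<close>, so its squared norm
      is at least \<open>m i\<close>; this is the lower bound that the parallelogram law
      needs.\<close>
    have "midpoint (p i) (p j) \<in> C i"
      using convexD[OF convex[of i], of "p i" "p j" "1/2" "1/2"] p(1) sub[OF that]
      by (auto simp: midpoint_def scaleR_add_right)
    from m_le[OF this] have "m i \<le> (norm (midpoint (p i) (p j)))\<^sup>2" .
    moreover have "1 / real (Suc j) \<le> 1 / real (Suc i)"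
      using that by (simp add: frac_le)
    ultimately show ?thesis
      using parallelogram_midpoint[of "p i" "p j"] p(2)[of i] p(2)[of j] abs_ge_self[of "m j - m i"]
      unfolding dist_norm by argo
  qed
  have "Cauchy p"
  proof (rule metric_CauchyI)
    fix e :: real assume "e > 0"
    then have "0 < e\<^sup>2 / 4" by simp
    obtain N1 where N1: "\<And>i j. i \<ge> N1 \<Longrightarrow> j \<ge> N1 \<Longrightarrow> dist (m j) (m i) < e\<^sup>2 / 4"
      using metric_CauchyD[OF \<open>Cauchy m\<close> \<open>0 < e\<^sup>2/4\<close>] by auto
    obtain N2 where N2: "8 / e\<^sup>2 < real N2" using reals_Archimedean2 by blast
    define N where "N = max N1 N2"
    have *: "dist (p i) (p j) < e" if "N \<le> i" "i \<le> j" for i j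
    proof -
      have "8 / e\<^sup>2 < real (Suc i)" using N2 that unfolding N_def by auto
      then have "4 / real (Suc i) < e\<^sup>2 / 2"
        using \<open>e > 0\<close> by (simp add: field_simps)
      moreover have "\<bar>m j - m i\<bar> < e\<^sup>2 / 4"
        using N1[of i j] that unfolding N_def dist_real_def by auto
      ultimately have "(dist (p i) (p j))\<^sup>2 < e\<^sup>2"
        using dist2[OF that(2)] by simp
      then show ?thesis using \<open>e > 0\<close> by (simp add: power2_less_imp_less)
    qed
    show "\<exists>M. \<forall>i\<ge>M. \<forall>j\<ge>M. dist (p i) (p j) < e"
      using * by (metis dist_commute nle_le)
  qed
  then obtain w where w: "p \<longlonglongrightarrow> w"
    using Cauchy_convergent_iff convergent_def by blast
  have "w \<in> C n" for n
  proof (rule closed_sequentially[OF closed])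
    show "(\<lambda>k. p (k + n)) \<longlonglongrightarrow> w" by (rule LIMSEQ_ignore_initial_segment[OF w])
    show "p (k + n) \<in> C n" for k using p(1)[of "k + n"] sub[OF le_add2, of k n] by blast
  qed
  then show ?thesis by blast
qed

locale moreau =
  fixes f :: "'a::{real_inner, banach} \<Rightarrow> ereal"
  assumes proper: "proper f" and convex: "convex_ereal f"
    and lsc: "lower_semicontinuous f" and argmin: "argmin f \<noteq> {}"
begin

section \<open>Minimizers, sublevel sets and proximal points\<close>

lemma argmin_value:
  assumes "z \<in> argmin f"
  shows "f z = ereal (min_value f)"
proof -
  have le: "f z \<le> f y" for y
    using assms by (auto simp: argmin_def is_arg_min_def not_less)
  have "(INF y. f y) = f z"
    using le by (intro antisym INF_greatest INF_lower) auto
  moreover have "f z \<noteq> \<infinity>" "f z \<noteq> -\<infinity>"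
    using proper le unfolding proper_def by (metis ereal_infty_less_eq(1))+
  ultimately show ?thesis
    unfolding min_value_def by (cases "f z") auto
qed

lemma min_value_le: "ereal (min_value f) \<le> f y"
proof -
  obtain z where "z \<in> argmin f" using argmin by blast
  with argmin_value[OF this] show ?thesis
    by (auto simp: argmin_def is_arg_min_def not_less)
qed

lemma argminI:
  assumes "f z \<le> ereal (min_value f)"
  shows "z \<in> argmin f"
  using order_trans[OF assms min_value_le] by (auto simp: argmin_def is_arg_min_def not_less)

text \<open>A real number strictly between \<open>k y\<close> and \<open>f y\<close> separates the
  two functions near \<open>y\<close>. The variable threshold expresses sublevel sets of
  \<open>f\<close> plus a quadratic without adding extended reals.\<close>

lemma closed_le_continuous:
  assumes "continuous_on UNIV k"
  shows "closed {y. f y \<le> ereal (k y)}"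
proof -
  have "\<exists>S. open S \<and> y \<in> S \<and> S \<subseteq> - {y. f y \<le> ereal (k y)}" if "\<not> f y \<le> ereal (k y)" for y
  proof -
    obtain r where r: "k y < r" "ereal r < f y"
      using ereal_dense2[of "ereal (k y)" "f y"] \<open>\<not> f y \<le> ereal (k y)\<close> by (metis less_ereal.simps(1) not_le)
    then have "ereal r < Liminf (nhds y) f"
      using lsc unfolding lower_semicontinuous_def by (meson less_le_trans)
    then have "\<forall>\<^sub>F s in nhds y. ereal r < f s"
      by (rule less_LiminfD)
    moreover have "\<forall>\<^sub>F s in nhds y. k s < r"
    proof -
      have "(k \<longlongrightarrow> k y) (nhds y)"
        using assms by (simp add: continuous_on_eq_continuous_at isCont_def tendsto_at_iff_tendsto_nhds)
      then show ?thesis using r(1) by (rule order_tendstoD(2))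
    qed
    ultimately have "\<forall>\<^sub>F s in nhds y. \<not> f s \<le> ereal (k s)"
      by eventually_elim (auto simp: not_le intro: order.strict_trans[rotated])
    then show ?thesis
      unfolding eventually_nhds by blast
  qed
  then have "open (- {y. f y \<le> ereal (k y)})"
    by (subst open_subopen) auto
  then show ?thesis by (simp add: closed_def)
qed

lemma norm_sq_convex_combination:
  fixes a b :: "'a"
  shows "(norm ((1 - u) *\<^sub>R a + u *\<^sub>R b))\<^sup>2 =
    (1 - u) * (norm a)\<^sup>2 + u * (norm b)\<^sup>2 - u * (1 - u) * (norm (a - b))\<^sup>2"
  unfolding power2_norm_eq_inner
  by (simp add: inner_add_left inner_add_right inner_diff_left inner_diff_right inner_commute[of b a] algebra_simps)

text \<open>This is a sublevel set of \<open>f\<close> plus a quadratic, with the quadratic moved to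
  the real side. The convexity defect of the quadratic has the sign of \<open>k\<close>.\<close>

lemma convex_le_minus_norm_sq:
  assumes "k \<ge> 0"
  shows "convex {y. f y \<le> ereal (c - k * (norm (x - y))\<^sup>2)}" (is "convex ?S")
  unfolding convex_alt
proof (intro ballI allI impI)
  fix a b and u :: real assume a: "a \<in> ?S" and b: "b \<in> ?S" and "0 \<le> u \<and> u \<le> 1"
  then consider "u = 0" | "u = 1" | "0 < u" "u < 1" by linarith
  then show "(1 - u) *\<^sub>R a + u *\<^sub>R b \<in> ?S"
  proof cases
    case 3
    have eq: "x - ((1 - u) *\<^sub>R a + u *\<^sub>R b) = (1 - u) *\<^sub>R (x - a) + u *\<^sub>R (x - b)"
      by (simp add: algebra_simps)
    have "0 \<le> k * (u * (1 - u) * (norm (x - a - (x - b)))\<^sup>2)"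
      using 3 assms by simp
    then have "(1 - u) * (c - k * (norm (x - a))\<^sup>2) + u * (c - k * (norm (x - b))\<^sup>2)
        \<le> c - k * (norm (x - ((1 - u) *\<^sub>R a + u *\<^sub>R b)))\<^sup>2"
      unfolding eq norm_sq_convex_combination by (simp add: algebra_simps)
    moreover have "f ((1 - u) *\<^sub>R a + u *\<^sub>R b) \<le> ereal (1 - u) * f a + ereal u * f b"
      using convex 3 by (auto simp: convex_ereal_def)
    moreover have "\<dots> \<le> ereal (1 - u) * ereal (c - k * (norm (x - a))\<^sup>2) + ereal u * ereal (c - k * (norm (x - b))\<^sup>2)"
      using a b 3 by (intro add_mono ereal_mult_left_mono) auto
    ultimately have "f ((1 - u) *\<^sub>R a + u *\<^sub>R b) \<le> ereal (c - k * (norm (x - ((1 - u) *\<^sub>R a + u *\<^sub>R b)))\<^sup>2)"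
      by (simp only: times_ereal.simps plus_ereal.simps) (meson ereal_less_eq(3) order_trans)
    then show ?thesis by simp
  qed (use a b in auto)
qed

text \<open>The sets \<open>C n\<close> collect the points where the penalized function is within
  \<open>1 / (n + 1)\<close> of its infimum. They are closed, convex and decreasing, and the lower
  bound on \<open>f\<close> makes them bounded, so they have a common point; it attains the
  infimum.\<close>

lemma proximal_point_exists:
  assumes "l > 0"
  obtains p r where "f p = ereal r" and "moreau_envelope f l x = r + 1 / (2 * l) * (norm (x - p))\<^sup>2"
    and "\<And>y. ereal (r + 1 / (2 * l) * (norm (x - p))\<^sup>2) \<le> f y + ereal (1 / (2 * l) * (norm (x - y))\<^sup>2)"
proof -
  define h where "h y = 1 / (2 * l) * (norm (x - y))\<^sup>2" for y
  define m where "m = (INF y. f y + ereal (h y))"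
  have h0: "h y \<ge> 0" for y using assms by (simp add: h_def)
  have m_le: "m \<le> f y + ereal (h y)" for y
    unfolding m_def by (rule INF_lower) simp
  obtain y1 where y1: "f y1 \<noteq> \<infinity>" using proper by (auto simp: proper_def)
  have "ereal (min_value f) \<le> m"
    unfolding m_def
  proof (rule INF_greatest)
    fix y show "ereal (min_value f) \<le> f y + ereal (h y)"
      using add_mono[OF min_value_le[of y], of 0 "ereal (h y)"] h0[of y] by simp
  qed
  moreover have "m \<noteq> \<infinity>" using m_le[of y1] y1 by auto
  ultimately obtain m' where m': "m = ereal m'" by (cases m) auto
  define C where "C n = {y. f y \<le> ereal (m' + 1 / real (Suc n) - 1 / (2 * l) * (norm (x - y))\<^sup>2)}" for n
  have "(\<Inter>n. C n) \<noteq> {}"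
  proof (rule decreasing_closed_convex_Inter_nonempty)
    show "closed (C n)" for n
      unfolding C_def by (intro closed_le_continuous continuous_intros) 
    show "convex (C n)" for n
      unfolding C_def using assms by (intro convex_le_minus_norm_sq) simp
    show "C n \<noteq> {}" for n
    proof -
      have "m < ereal (m' + 1 / real (Suc n))" by (simp add: m')
      then obtain y where y: "f y + ereal (h y) < ereal (m' + 1 / real (Suc n))"
        unfolding m_def by (auto simp: INF_less_iff)
      then have "f y \<le> ereal (m' + 1 / real (Suc n) - h y)"
        by (cases "f y") auto
      then show ?thesis by (auto simp: C_def h_def)
    qed
    show "decseq C"
      unfolding decseq_def
    proof (intro allI impI subsetI)
      fix i j :: nat and y assume "i \<le> j" and y: "y \<in> C j"
      then have "1 / real (Suc j) \<le> 1 / real (Suc i)" by (simp add: frac_le)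
      then show "y \<in> C i"
        using y order_trans unfolding C_def by fastforce
    qed
    have "norm (x - y) \<le> 2 * l * (m' + 1 - min_value f) + 1" if "y \<in> C 0" for y
    proof -
      have "ereal (min_value f) \<le> ereal (m' + 1 - 1 / (2 * l) * (norm (x - y))\<^sup>2)"
        using min_value_le[of y] that order_trans by (fastforce simp: C_def simp del: ereal_less_eq)
      then have "1 / (2 * l) * (norm (x - y))\<^sup>2 \<le> m' + 1 - min_value f" by simp
      then have "(norm (x - y))\<^sup>2 \<le> 2 * l * (m' + 1 - min_value f)"
        using assms by (simp add: field_simps)
      \<comment> \<open>Bounding a number by its square plus one is enough for boundedness and
        avoids a root.\<close>
      moreover have "norm (x - y) \<le> (norm (x - y))\<^sup>2 + 1"
        using zero_le_power2[of "norm (x - y) - 1"] by (simp add: power2_diff) (smt (verit) zero_le_power2)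
      ultimately show ?thesis by simp
    qed
    then have "C 0 \<subseteq> cball x (2 * l * (m' + 1 - min_value f) + 1)" by (auto simp: dist_norm)
    then show "bounded (C 0)" using bounded_cball bounded_subset by blast
  qed
  then obtain p where p: "\<And>n. p \<in> C n" by blast
  obtain r where r: "f p = ereal r"
    using p[of 0] min_value_le[of p] by (cases "f p") (auto simp: C_def)
  have "r + h p \<le> m'"
  proof (rule field_le_epsilon)
    fix e :: real assume "e > 0"
    then obtain n where "inverse (real (Suc n)) < e" using reals_Archimedean by blast
    then show "r + h p \<le> m' + e"
      using p[of n] r by (simp add: C_def h_def inverse_eq_divide)
  qed
  moreover have "m' \<le> r + h p" using m_le[of p] r m' by simp
  ultimately have eq: "m' = r + h p" by simp
  show ?thesis
  proof (rule that[OF r])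
    show "moreau_envelope f l x = r + 1 / (2 * l) * (norm (x - p))\<^sup>2"
      using m' eq by (simp add: moreau_envelope_def m_def h_def)
    show "ereal (r + 1 / (2 * l) * (norm (x - p))\<^sup>2) \<le> f y + ereal (1 / (2 * l) * (norm (x - y))\<^sup>2)" for y
      using m_le[of y] m' eq by (simp add: h_def)
  qed
qed

text \<open>Optimality of the proximal point \<open>p\<close> against
  \<open>(1 - u) p + u y\<close>, divided by \<open>u\<close> as \<open>u\<close> tends to 0, makes
  \<open>g = (x - p) / l\<close> a subgradient of \<open>f\<close> at \<open>p\<close>. At this
  stage \<open>g\<close> is only a witness; differentiability of the envelope is deduced from the
  three properties obtained here.\<close>

lemma proximal_point_subgradient:
  assumes "l > 0"
  obtains g r where "f (x - l *\<^sub>R g) = ereal r" and "moreau_envelope f l x = r + l / 2 * (norm g)\<^sup>2"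
    and "\<And>y. ereal (r + inner g (y - (x - l *\<^sub>R g))) \<le> f y"
proof -
  obtain p r where r: "f p = ereal r" and env: "moreau_envelope f l x = r + 1 / (2 * l) * (norm (x - p))\<^sup>2"
    and min: "\<And>y. ereal (r + 1 / (2 * l) * (norm (x - p))\<^sup>2) \<le> f y + ereal (1 / (2 * l) * (norm (x - y))\<^sup>2)"
    using proximal_point_exists[OF assms] by blast
  define g where "g = (1 / l) *\<^sub>R (x - p)"
  have lg: "l *\<^sub>R g = x - p" using assms by (simp add: g_def)
  then have p: "x - l *\<^sub>R g = p" by simp
  have sub: "ereal (r + inner g (y - p)) \<le> f y" for y
  proof (cases "f y")
    case (real s)
    have small: "r + inner g (y - p) \<le> s + u * ((norm (y - p))\<^sup>2 / (2 * l))" if u: "0 < u" "u < 1" for u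
    proof -
      have "f ((1 - u) *\<^sub>R p + u *\<^sub>R y) \<le> ereal ((1 - u) * r + u * s)"
        using convex[unfolded convex_ereal_def, rule_format, of u p y] u r real by simp
      then obtain q where q: "f ((1 - u) *\<^sub>R p + u *\<^sub>R y) = ereal q" "q \<le> (1 - u) * r + u * s"
        using min_value_le[of "(1 - u) *\<^sub>R p + u *\<^sub>R y"] by (cases "f ((1 - u) *\<^sub>R p + u *\<^sub>R y)") auto
      have "r + 1 / (2 * l) * (norm (x - p))\<^sup>2 \<le> q + 1 / (2 * l) * (norm (x - ((1 - u) *\<^sub>R p + u *\<^sub>R y)))\<^sup>2"
        using min[of "(1 - u) *\<^sub>R p + u *\<^sub>R y"] q(1) by simp
      moreover have "x - ((1 - u) *\<^sub>R p + u *\<^sub>R y) = l *\<^sub>R g - u *\<^sub>R (y - p)"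
        unfolding lg by (simp add: algebra_simps)
      moreover have "(norm (l *\<^sub>R g - u *\<^sub>R (y - p)))\<^sup>2 =
          (norm (x - p))\<^sup>2 - 2 * l * (u * inner g (y - p)) + u\<^sup>2 * (norm (y - p))\<^sup>2"
        unfolding lg[symmetric] power2_norm_eq_inner
        by (simp add: inner_diff_left inner_diff_right inner_commute power2_eq_square algebra_simps)
      ultimately have "r + 1 / (2 * l) * (norm (x - p))\<^sup>2 \<le> (1 - u) * r + u * s + 1 / (2 * l) *
          ((norm (x - p))\<^sup>2 - 2 * l * (u * inner g (y - p)) + u\<^sup>2 * (norm (y - p))\<^sup>2)"
        using q(2) by simp
      also have "\<dots> = (1 - u) * r + u * s + 1 / (2 * l) * (norm (x - p))\<^sup>2 - u * inner g (y - p)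
          + u\<^sup>2 * ((norm (y - p))\<^sup>2 / (2 * l))"
        using assms by (simp add: field_simps)
      \<comment> \<open>The constant terms cancel and each side keeps a factor \<open>u\<close>; the
        quadratic term keeps a second one and vanishes in the limit.\<close>
      finally have "u * (r + inner g (y - p)) \<le> u * (s + u * ((norm (y - p))\<^sup>2 / (2 * l)))"
        by (simp add: algebra_simps power2_eq_square)
      then show ?thesis using u(1) by simp
    qed
    have lim: "((\<lambda>u. s + u * ((norm (y - p))\<^sup>2 / (2 * l))) \<longlongrightarrow> s + 0 * ((norm (y - p))\<^sup>2 / (2 * l))) (at_right 0)"
      by (intro tendsto_intros)
    have ev: "\<forall>\<^sub>F u in at_right (0::real). r + inner g (y - p) \<le> s + u * ((norm (y - p))\<^sup>2 / (2 * l))"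
      by (rule eventually_at_rightI[of 0 1]) (use small in auto)
    have "r + inner g (y - p) \<le> s"
      using tendsto_lowerbound[OF lim ev] by simp
    then show ?thesis using real by simp
  qed (use min_value_le[of y] in auto)
  show ?thesis
  proof (rule that[of g r])
    show "f (x - l *\<^sub>R g) = ereal r" using r p by simp
    show "moreau_envelope f l x = r + l / 2 * (norm g)\<^sup>2"
      using env assms unfolding lg[symmetric] by (simp add: power_mult_distrib power2_eq_square)
    show "ereal (r + inner g (y - (x - l *\<^sub>R g))) \<le> f y" for y
      using sub p by simp
  qed
qed

text \<open>Every property of the envelope needed below is a consequence of the next inequality. At equal
  parameters it is co-coercivity; by symmetry it sandwiches the increment of the envelope.\<close>

lemma envelope_increment_witness:
  assumes g: "f (x - l *\<^sub>R g) = ereal r" "moreau_envelope f l x = r + l / 2 * (norm g)\<^sup>2"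
      "\<And>y. ereal (r + inner g (y - (x - l *\<^sub>R g))) \<le> f y"
    and h: "f (y - m *\<^sub>R h) = ereal s" "moreau_envelope f m y = s + m / 2 * (norm h)\<^sup>2"
  shows "moreau_envelope f l x + inner g (y - x) - (m - l) / 2 * (norm g)\<^sup>2 + m / 2 * (norm (g - h))\<^sup>2
    \<le> moreau_envelope f m y"
proof -
  have "r + inner g (y - m *\<^sub>R h - (x - l *\<^sub>R g)) \<le> s"
    using g(3)[of "y - m *\<^sub>R h"] h(1) by simp
  then show ?thesis
    unfolding g(2) h(2) power2_norm_eq_inner
    by (simp add: inner_diff_left inner_diff_right inner_commute[of h g] algebra_simps diff_divide_distrib add_divide_distrib)
qed

text \<open>The increment inequality in both directions traps the first-order remainder between 0
  and \<open>D * norm (y - x)\<close>, where \<open>D\<close> is the distance of the two witnesses.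
  The sum of both directions is co-coercivity, which bounds \<open>l * D\<close> by
  \<open>norm (y - x)\<close>; the remainder is therefore quadratic.\<close>

lemma GDERIV_moreau_envelope_witness:
  assumes "l > 0" and g: "f (x - l *\<^sub>R g) = ereal r" "moreau_envelope f l x = r + l / 2 * (norm g)\<^sup>2"
      "\<And>y. ereal (r + inner g (y - (x - l *\<^sub>R g))) \<le> f y"
  shows "GDERIV (moreau_envelope f l) x :> g"
  unfolding gderiv_def has_derivative_iff_norm
proof (intro conjI)
  show "bounded_linear (\<lambda>h. inner h g)" by (rule bounded_linear_inner_left)
  let ?e = "moreau_envelope f l"
  have bound: "norm (norm (?e y - ?e x - inner (y - x) g) / norm (y - x)) \<le> norm (y - x) / l" for y
  proof -
    obtain h s where h: "f (y - l *\<^sub>R h) = ereal s" "?e y = s + l / 2 * (norm h)\<^sup>2"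
       "\<And>z. ereal (s + inner h (z - (y - l *\<^sub>R h))) \<le> f z"
      using proximal_point_subgradient[OF \<open>l > 0\<close>] by blast
    define D where "D = norm (h - g)"
    have 1: "?e x + inner g (y - x) + l / 2 * D\<^sup>2 \<le> ?e y"
      using envelope_increment_witness[OF g h(1,2)] by (simp add: D_def norm_minus_commute)
    have 2: "?e y + inner h (x - y) + l / 2 * D\<^sup>2 \<le> ?e x"
      using envelope_increment_witness[OF h g(1,2)] by (simp add: D_def)
    have D2: "0 \<le> l / 2 * D\<^sup>2" using \<open>l > 0\<close> by simp
    have cs: "inner (h - g) (y - x) \<le> D * norm (y - x)"
      unfolding D_def by (rule norm_cauchy_schwarz)
    have "l * D\<^sup>2 \<le> inner (h - g) (y - x)"
      using 1 2 by (simp add: inner_diff_left inner_diff_right algebra_simps)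
    with cs have "D * (l * D) \<le> D * norm (y - x)" by (simp add: power2_eq_square algebra_simps)
    then have lD: "l * D \<le> norm (y - x)"
      by (cases "D = 0") (auto simp: D_def)
    have up: "?e y - ?e x - inner (y - x) g \<le> D * norm (y - x)"
      using 2 cs D2
      by (simp add: inner_diff_left inner_diff_right inner_commute algebra_simps)
    have lo: "0 \<le> ?e y - ?e x - inner (y - x) g"
      using 1 D2 by (simp add: inner_commute)
    have "l * (?e y - ?e x - inner (y - x) g) \<le> (l * D) * norm (y - x)"
      using up \<open>l > 0\<close> by (simp add: mult.assoc)
    also have "\<dots> \<le> norm (y - x) * norm (y - x)"
      using lD by (intro mult_right_mono) auto
    finally show ?thesis
      using lo \<open>l > 0\<close> by (cases "y = x") (auto simp: field_simps abs_mult)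
  qed
  have "((\<lambda>y. norm (y - x) / l) \<longlongrightarrow> norm (x - x) / l) (at x)"
    using \<open>l > 0\<close> by (intro tendsto_intros) auto
  then have "((\<lambda>y. norm (y - x) / l) \<longlongrightarrow> 0) (at x)" by simp
  then show "((\<lambda>y. norm (?e y - ?e x - inner (y - x) g) / norm (y - x)) \<longlongrightarrow> 0) (at x)"
    by (rule Lim_null_comparison[rotated]) (use bound in \<open>auto intro: always_eventually\<close>)
qed

lemma moreau_gradient_subgradient:
  fixes x :: 'a
  assumes "l > 0"
  defines "g \<equiv> gradient (moreau_envelope f l) x"
  obtains r where "f (x - l *\<^sub>R g) = ereal r" and "moreau_envelope f l x = r + l / 2 * (norm g)\<^sup>2"
    and "\<And>y. ereal (r + inner g (y - (x - l *\<^sub>R g))) \<le> f y"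
proof -
  obtain h s where h: "f (x - l *\<^sub>R h) = ereal s" "moreau_envelope f l x = s + l / 2 * (norm h)\<^sup>2"
       "\<And>z. ereal (s + inner h (z - (x - l *\<^sub>R h))) \<le> f z"
    using proximal_point_subgradient[OF \<open>l > 0\<close>] by blast
  have "g = h"
    unfolding g_def using GDERIV_moreau_envelope_witness[OF \<open>l > 0\<close> h] by (rule gradient_eqI)
  with h show ?thesis using that by blast
qed

section \<open>The envelope as a function of its parameter and its point\<close>

abbreviation env :: "real \<Rightarrow> 'a \<Rightarrow> real" where "env \<equiv> moreau_envelope f"
abbreviation grad :: "real \<Rightarrow> 'a \<Rightarrow> 'a" where "grad l \<equiv> gradient (env l)"

lemma env_increment:
  assumes "l > 0" "m > 0"
  shows "env l x + inner (grad l x) (y - x) - (m - l) / 2 * (norm (grad l x))\<^sup>2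
      + m / 2 * (norm (grad l x - grad m y))\<^sup>2 \<le> env m y"
proof -
  obtain r where r: "f (x - l *\<^sub>R grad l x) = ereal r" "env l x = r + l / 2 * (norm (grad l x))\<^sup>2"
    "\<And>y. ereal (r + inner (grad l x) (y - (x - l *\<^sub>R grad l x))) \<le> f y"
    using moreau_gradient_subgradient[OF assms(1)] by blast
  obtain s where s: "f (y - m *\<^sub>R grad m y) = ereal s" "env m y = s + m / 2 * (norm (grad m y))\<^sup>2"
    using moreau_gradient_subgradient[OF assms(2)] by blast
  show ?thesis by (rule envelope_increment_witness[OF r s])
qed

text \<open>The subgradient inequality tested at \<open>z\<close> itself bounds
  \<open>r + l |g|^2\<close> by the minimum, while \<open>r\<close> is a value of \<open>f\<close>;
  together they force the gradient to vanish.\<close>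

lemma grad_argmin:
  assumes "l > 0" "z \<in> argmin f"
  shows "env l z = min_value f" and "grad l z = 0"
proof -
  obtain r where r: "f (z - l *\<^sub>R grad l z) = ereal r" "env l z = r + l / 2 * (norm (grad l z))\<^sup>2"
    "\<And>y. ereal (r + inner (grad l z) (y - (z - l *\<^sub>R grad l z))) \<le> f y"
    using moreau_gradient_subgradient[OF assms(1)] by blast
  have "min_value f \<le> r" using min_value_le[of "z - l *\<^sub>R grad l z"] r(1) by simp
  moreover have le: "r + l * (norm (grad l z))\<^sup>2 \<le> min_value f"
    using r(3)[of z] argmin_value[OF assms(2)] by (simp add: power2_norm_eq_inner)
  ultimately have "l * (norm (grad l z))\<^sup>2 \<le> 0" by linarith
  then show "grad l z = 0" using assms(1) by (simp add: mult_le_0_iff)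
  then show "env l z = min_value f" using le \<open>min_value f \<le> r\<close> r(2) by simp
qed

text \<open>The increment inequality from \<open>x\<close> to \<open>z\<close>, where the gradient
  vanishes. In the energy estimate it trades the inner product with the gradient for the
  gap.\<close>

lemma grad_coercive:
  assumes "l > 0" "z \<in> argmin f"
  shows "env l x - min_value f + l / 2 * (norm (grad l x))\<^sup>2 \<le> inner (x - z) (grad l x)"
  using env_increment[OF assms(1,1), of x z] grad_argmin[OF assms]
  by (simp add: inner_diff_left inner_diff_right inner_commute)

text \<open>The increment from a minimizer, where the gradient vanishes, leaves only the quadratic
  term. Along the trajectory \<open>l\<close> becomes \<open>\<gamma> t\<close>, so a large
  parameter sharpens the control of the gradient by the gap.\<close>

lemma grad_norm_sq_le:
  assumes "l > 0"
  shows "l / 2 * (norm (grad l x))\<^sup>2 \<le> env l x - min_value f"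
proof -
  obtain z where "z \<in> argmin f" using argmin by blast
  then show ?thesis using env_increment[OF assms assms, of z x] grad_argmin[OF assms, of z] by simp
qed

lemma env_ge_min_value:
  assumes "l > 0"
  shows "min_value f \<le> env l x"
proof -
  have "0 \<le> l / 2 * (norm (grad l x))\<^sup>2" using assms by simp
  then show ?thesis using grad_norm_sq_le[OF assms, of x] by linarith
qed

text \<open>An envelope lies below \<open>f\<close>, and \<open>f\<close> at a proximal point lies
  below the envelope that produced it. This compares the varying parameter along the trajectory with
  a fixed one.\<close>

lemma env_proximal_point_le:
  assumes "l > 0" "m > 0"
  shows "env m (x - l *\<^sub>R grad l x) \<le> env l x"
proof -
  let ?p = "x - l *\<^sub>R grad l x"
  obtain r where r: "f ?p = ereal r" "env l x = r + l / 2 * (norm (grad l x))\<^sup>2"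
    using moreau_gradient_subgradient[OF assms(1)] by blast
  obtain s where s: "env m ?p = s + m / 2 * (norm (grad m ?p))\<^sup>2"
    "\<And>y. ereal (s + inner (grad m ?p) (y - (?p - m *\<^sub>R grad m ?p))) \<le> f y"
    using moreau_gradient_subgradient[OF assms(2)] by blast
  have "s + m * (norm (grad m ?p))\<^sup>2 \<le> r"
    using s(2)[of ?p] r(1) by (simp add: power2_norm_eq_inner)
  moreover have "0 \<le> l / 2 * (norm (grad l x))\<^sup>2" "0 \<le> m / 2 * (norm (grad m ?p))\<^sup>2"
    using assms by simp_all
  ultimately show ?thesis
    unfolding s(1) r(2) by linarith
qed

text \<open>The gradient must vanish, so \<open>z\<close> is its own proximal point and
  \<open>f z\<close> equals the envelope there.\<close>

lemma argmin_envI: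
  assumes "l > 0" "env l z \<le> min_value f"
  shows "z \<in> argmin f"
proof -
  have "l / 2 * (norm (grad l z))\<^sup>2 \<le> 0"
    using grad_norm_sq_le[OF assms(1), of z] assms(2) by linarith
  then have "grad l z = 0" using assms(1) by (simp add: mult_le_0_iff)
  then obtain r where "f z = ereal r" "env l z = r"
    using moreau_gradient_subgradient[OF assms(1), of z] by auto
  then show ?thesis using assms(2) by (intro argminI) simp
qed

text \<open>The sum of two increment inequalities contains a difference of squared norms, which
  factors through \<open>h - g\<close> and so carries a factor \<open>D\<close>. Its part quadratic
  in \<open>D\<close> is absorbed on the left, where
  \<open>(l + m) / 2 - \<bar>l - m\<bar> / 2 = min l m\<close> survives; the rest involves only the
  gradient at \<open>x\<close>.\<close>

lemma grad_dist_le: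
  assumes "l > 0" "m > 0"
  shows "min l m * norm (grad m y - grad l x) \<le> norm (y - x) + \<bar>m - l\<bar> * norm (grad l x)"
proof -
  define g h where "g = grad l x" and "h = grad m y"
  define D where "D = norm (h - g)"
  have "env l x + inner g (y - x) - (m - l) / 2 * (norm g)\<^sup>2 + m / 2 * D\<^sup>2 \<le> env m y"
    "env m y + inner h (x - y) - (l - m) / 2 * (norm h)\<^sup>2 + l / 2 * D\<^sup>2 \<le> env l x"
    using env_increment[OF assms, of x y] env_increment[OF assms(2,1), of y x]
    by (simp_all add: g_def h_def D_def norm_minus_commute)
  then have "(l + m) / 2 * D\<^sup>2 \<le> inner (h - g) (y - x) + (l - m) / 2 * ((norm h)\<^sup>2 - (norm g)\<^sup>2)"
    by (simp add: inner_diff_left inner_diff_right field_simps)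
  also have "(norm h)\<^sup>2 - (norm g)\<^sup>2 = inner (h - g) (h + g)"
    by (simp add: power2_norm_eq_inner inner_diff_left inner_diff_right inner_add_right inner_commute)
  also have "inner (h - g) (y - x) \<le> D * norm (y - x)"
    unfolding D_def by (rule norm_cauchy_schwarz)
  also have "(l - m) / 2 * inner (h - g) (h + g) \<le> \<bar>l - m\<bar> / 2 * (D * (D + 2 * norm g))"
  proof -
    have "norm (h + g) \<le> D + 2 * norm g"
    proof -
      have eq: "(h - g) + 2 *\<^sub>R g = h + g" by (simp add: scaleR_2)
      show ?thesis using norm_triangle_ineq[of "h - g" "2 *\<^sub>R g"] unfolding eq by (simp add: D_def)
    qed
    then have "D * norm (h + g) \<le> D * (D + 2 * norm g)"
      by (intro mult_left_mono) (auto simp: D_def)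
    then have "\<bar>inner (h - g) (h + g)\<bar> \<le> D * (D + 2 * norm g)"
      using Cauchy_Schwarz_ineq2[of "h - g" "h + g"] unfolding D_def by linarith
    then have "\<bar>(l - m) / 2 * inner (h - g) (h + g)\<bar> \<le> \<bar>l - m\<bar> / 2 * (D * (D + 2 * norm g))"
      unfolding abs_mult by (intro mult_mono) auto
    then show ?thesis by linarith
  qed
  finally have "D * (((l + m) / 2 - \<bar>l - m\<bar> / 2) * D) \<le> D * (norm (y - x) + \<bar>l - m\<bar> * norm g)"
    by (simp add: power2_eq_square algebra_simps)
  moreover have "(l + m) / 2 - \<bar>l - m\<bar> / 2 = min l m" by (auto simp: min_def abs_if field_simps)
  ultimately have "D * (min l m * D) \<le> D * (norm (y - x) + \<bar>m - l\<bar> * norm g)"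
    by (simp add: abs_minus_commute)
  then show ?thesis
    by (cases "D = 0") (auto simp: D_def g_def h_def)
qed

lemma tendsto_grad:
  assumes l: "(l \<longlongrightarrow> l0) F" "l0 > 0" and x: "(x \<longlongrightarrow> x0) F"
  shows "((\<lambda>s. grad (l s) (x s)) \<longlongrightarrow> grad l0 x0) F"
proof -
  have "((\<lambda>s. (2 / l0) * (norm (x s - x0) + \<bar>l s - l0\<bar> * norm (grad l0 x0))) \<longlongrightarrow>
      (2 / l0) * (norm (x0 - x0) + \<bar>l0 - l0\<bar> * norm (grad l0 x0))) F"
    by (intro tendsto_intros l x)
  then have lim: "((\<lambda>s. (2 / l0) * (norm (x s - x0) + \<bar>l s - l0\<bar> * norm (grad l0 x0))) \<longlongrightarrow> 0) F"
    by simp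
  have "\<forall>\<^sub>F s in F. l0 / 2 < l s"
    using l by (intro order_tendstoD(1)[OF l(1)]) simp
  then have "\<forall>\<^sub>F s in F. norm (grad (l s) (x s) - grad l0 x0)
      \<le> (2 / l0) * (norm (x s - x0) + \<bar>l s - l0\<bar> * norm (grad l0 x0))"
  proof eventually_elim
    case (elim s)
    then have "l s > 0" using l(2) by linarith
    have "l0 / 2 * norm (grad (l s) (x s) - grad l0 x0) \<le> min l0 (l s) * norm (grad (l s) (x s) - grad l0 x0)"
      using elim l(2) by (intro mult_right_mono) auto
    also have "\<dots> \<le> norm (x s - x0) + \<bar>l s - l0\<bar> * norm (grad l0 x0)"
      by (rule grad_dist_le[OF l(2) \<open>l s > 0\<close>])
    finally show ?case using l(2) by (simp add: field_simps)
  qed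
  then show ?thesis
    by (intro Lim_null_comparison[OF _ lim, THEN LIM_zero_cancel])
qed

text \<open>The increment of the envelope is trapped between the linear expression with the gradient
  at \<open>t\<close> and the one with the gradient at \<open>s\<close>. Continuity of the gradient
  closes the gap, so the gradient itself is never differentiated. The term
  \<open>- |g|^2 / 2\<close> is the derivative in the parameter.\<close>

lemma env_has_real_derivative_along:
  assumes l: "(l has_real_derivative l') (at t)" and x: "(x has_vector_derivative x') (at t)"
    and pos: "l t > 0"
  shows "((\<lambda>s. env (l s) (x s)) has_real_derivative
    (inner (grad (l t) (x t)) x' - l' / 2 * (norm (grad (l t) (x t)))\<^sup>2)) (at t)"
proof -
  define g where "g s = grad (l s) (x s)" for s
  define q where "q s = (1 / (s - t)) *\<^sub>R (x s - x t)" for s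
  define r where "r s = (l s - l t) / (s - t)" for s
  define \<Delta> where "\<Delta> s = env (l s) (x s) - env (l t) (x t)" for s
  define A where "A s = inner (g t) (x s - x t) - (l s - l t) / 2 * (norm (g t))\<^sup>2" for s
  have lc: "(l \<longlongrightarrow> l t) (at t)"
    using DERIV_isCont[OF l] by (simp add: isCont_def)
  have xc: "(x \<longlongrightarrow> x t) (at t)"
    using has_vector_derivative_continuous[OF x] by (simp add: continuous_within)
  have g: "(g \<longlongrightarrow> g t) (at t)"
    unfolding g_def by (rule tendsto_grad[OF lc pos xc])
  have q: "(q \<longlongrightarrow> x') (at t)"
  proof -
    have "((\<lambda>s. norm (x s - x t - (s - t) *\<^sub>R x') / norm (s - t)) \<longlongrightarrow> 0) (at t)"
      using x unfolding has_vector_derivative_def has_derivative_iff_norm by blast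
    moreover have "norm (x s - x t - (s - t) *\<^sub>R x') / norm (s - t) = norm (q s - x')" if "s \<noteq> t" for s
    proof -
      have "q s - x' = (1 / (s - t)) *\<^sub>R (x s - x t - (s - t) *\<^sub>R x')"
        using that by (simp add: q_def scaleR_diff_right)
      then show ?thesis by simp
    qed
    ultimately have "((\<lambda>s. norm (q s - x')) \<longlongrightarrow> 0) (at t)"
      by (auto elim!: Lim_transform_eventually simp: eventually_at_filter)
    then show ?thesis by (simp add: tendsto_norm_zero_iff LIM_zero_iff)
  qed
  have r: "(r \<longlongrightarrow> l') (at t)"
    using l unfolding has_field_derivative_iff r_def .
  have "((\<lambda>s. inner (g t) (q s) - r s / 2 * (norm (g t))\<^sup>2) \<longlongrightarrow> inner (g t) x' - l' / 2 * (norm (g t))\<^sup>2) (at t)"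
    by (intro tendsto_intros q r) simp
  moreover have "inner (g t) (q s) - r s / 2 * (norm (g t))\<^sup>2 = A s / (s - t)" if "s \<noteq> t" for s
  proof -
    have "1 / d * I - L / d / 2 * Q = (I - L / 2 * Q) / d" for d I L Q :: real
      by (simp add: diff_divide_distrib)
    then show ?thesis unfolding A_def q_def r_def inner_scaleR_right by blast
  qed
  ultimately have A: "((\<lambda>s. A s / (s - t)) \<longlongrightarrow> inner (g t) x' - l' / 2 * (norm (g t))\<^sup>2) (at t)"
    by (auto elim!: Lim_transform_eventually simp: eventually_at_filter)
  have "((\<lambda>s. norm (g s - g t) * norm (q s) + \<bar>r s\<bar> / 2 * \<bar>(norm (g s))\<^sup>2 - (norm (g t))\<^sup>2\<bar>) \<longlongrightarrow>
      norm (g t - g t) * norm x' + \<bar>l'\<bar> / 2 * \<bar>(norm (g t))\<^sup>2 - (norm (g t))\<^sup>2\<bar>) (at t)"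
    by (intro tendsto_intros g q r) simp
  then have lim0: "((\<lambda>s. norm (g s - g t) * norm (q s) + \<bar>r s\<bar> / 2 * \<bar>(norm (g s))\<^sup>2 - (norm (g t))\<^sup>2\<bar>) \<longlongrightarrow> 0) (at t)"
    by simp
  have ev: "\<forall>\<^sub>F s in at t. norm (\<Delta> s / (s - t) - A s / (s - t))
      \<le> norm (g s - g t) * norm (q s) + \<bar>r s\<bar> / 2 * \<bar>(norm (g s))\<^sup>2 - (norm (g t))\<^sup>2\<bar>"
  proof -
    have "\<forall>\<^sub>F s in at t. l s > 0" by (rule order_tendstoD(1)[OF lc pos])
    moreover have "\<forall>\<^sub>F s in at t. s \<noteq> t" by (simp add: eventually_at_filter)
    ultimately show ?thesis
    proof eventually_elim
      case (elim s)
      have ls: "0 \<le> l s / 2 * (norm (g t - g s))\<^sup>2" "0 \<le> l t / 2 * (norm (g s - g t))\<^sup>2"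
        using elim pos by simp_all
      have 1: "A s \<le> \<Delta> s"
        using env_increment[OF pos elim(1), of "x t" "x s"] ls by (simp add: g_def A_def \<Delta>_def)
      have "\<Delta> s \<le> inner (g s) (x s - x t) - (l s - l t) / 2 * (norm (g s))\<^sup>2"
        using env_increment[OF elim(1) pos, of "x s" "x t"] ls
        by (simp add: g_def \<Delta>_def inner_diff_right algebra_simps diff_divide_distrib)
      then have "\<Delta> s - A s \<le> inner (g s - g t) (x s - x t) - (l s - l t) / 2 * ((norm (g s))\<^sup>2 - (norm (g t))\<^sup>2)"
        by (simp add: A_def inner_diff_left algebra_simps)
      also have "\<dots> \<le> norm (g s - g t) * norm (x s - x t) + \<bar>l s - l t\<bar> / 2 * \<bar>(norm (g s))\<^sup>2 - (norm (g t))\<^sup>2\<bar>"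
      proof -
        have "- ((l s - l t) / 2 * ((norm (g s))\<^sup>2 - (norm (g t))\<^sup>2)) \<le>
            \<bar>l s - l t\<bar> / 2 * \<bar>(norm (g s))\<^sup>2 - (norm (g t))\<^sup>2\<bar>"
          using abs_ge_minus_self[of "(l s - l t) / 2 * ((norm (g s))\<^sup>2 - (norm (g t))\<^sup>2)"]
          by (simp add: abs_mult)
        then show ?thesis
          using norm_cauchy_schwarz[of "g s - g t" "x s - x t"] by linarith
      qed
      finally have "\<bar>\<Delta> s - A s\<bar> \<le> norm (g s - g t) * norm (x s - x t) + \<bar>l s - l t\<bar> / 2 * \<bar>(norm (g s))\<^sup>2 - (norm (g t))\<^sup>2\<bar>"
        using 1 by simp
      then have "\<bar>\<Delta> s - A s\<bar> / \<bar>s - t\<bar> \<le>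
          (norm (g s - g t) * norm (x s - x t) + \<bar>l s - l t\<bar> / 2 * \<bar>(norm (g s))\<^sup>2 - (norm (g t))\<^sup>2\<bar>) / \<bar>s - t\<bar>"
        by (rule divide_right_mono) simp
      then show ?case
        by (simp add: q_def r_def add_divide_distrib flip: diff_divide_distrib)
    qed
  qed
  have "((\<lambda>s. \<Delta> s / (s - t) - A s / (s - t)) \<longlongrightarrow> 0) (at t)"
    using ev lim0 by (rule Lim_null_comparison)
  from tendsto_add[OF this A] have "((\<lambda>s. \<Delta> s / (s - t)) \<longlongrightarrow> inner (g t) x' - l' / 2 * (norm (g t))\<^sup>2) (at t)"
    by simp
  then show ?thesis
    unfolding has_field_derivative_iff \<Delta>_def g_def .
qed

end

section \<open>Weak cluster points and Opial's argument\<close>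

lemma decreasing_bounded_halfspace_cluster_point:
  fixes A :: "nat \<Rightarrow> 'a::{real_inner, banach} set"
  assumes "decseq A" "\<And>n. A n \<noteq> {}" "bounded (A 0)"
  obtains w where "\<And>n y c. (\<And>a. a \<in> A n \<Longrightarrow> inner a y \<le> c) \<Longrightarrow> inner w y \<le> c"
proof -
  \<comment> \<open>A closed half-space that contains a tail contains its closed convex hull. A
    common point of these hulls thus lies in every closed half-space that contains some
    tail.\<close>
  define C where "C n = closure (convex hull (A n))" for n
  have "(\<Inter>n. C n) \<noteq> {}"
  proof (rule decreasing_closed_convex_Inter_nonempty)
    show "decseq C"
      using assms(1) unfolding C_def decseq_def by (intro allI impI closure_mono hull_mono) auto
    show "bounded (C 0)"
      unfolding C_def using assms(3) by (intro bounded_closure bounded_convex_hull)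
  qed (use assms(2) in \<open>auto simp: C_def\<close>)
  then obtain w where w: "\<And>n. w \<in> C n" by blast
  show ?thesis
  proof (rule that[of w])
    fix n y c assume le: "\<And>a. a \<in> A n \<Longrightarrow> inner a y \<le> c"
    have "A n \<subseteq> {a. inner y a \<le> c}" using le by (auto simp: inner_commute)
    then have "convex hull (A n) \<subseteq> {a. inner y a \<le> c}"
      by (rule hull_minimal) (rule convex_halfspace_le)
    then have "C n \<subseteq> {a. inner y a \<le> c}"
      unfolding C_def by (rule closure_minimal) (rule closed_halfspace_le)
    then show "inner w y \<le> c" using w[of n] by (auto simp: inner_commute)
  qed
qed

text \<open>Cluster points are taken in the sense of closed half-spaces: this replaces weak sequential
  compactness of balls, and hence the Riesz representation theorem.\<close>

lemma opial_weak_convergence: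
  fixes x :: "real \<Rightarrow> 'a::{real_inner, banach}"
  assumes ne: "S \<noteq> {}"
    and lim: "\<And>z. z \<in> S \<Longrightarrow> \<exists>l. ((\<lambda>t. (norm (x t - z))\<^sup>2) \<longlongrightarrow> l) at_top"
    and cluster: "\<And>w. (\<And>y c. \<forall>\<^sub>F t in at_top. inner (x t) y \<le> c \<Longrightarrow> inner w y \<le> c) \<Longrightarrow> w \<in> S"
  shows "\<exists>z\<in>S. weakly_tendsto x z at_top"
proof -
  obtain z0 l0 where "z0 \<in> S" and l0: "((\<lambda>t. (norm (x t - z0))\<^sup>2) \<longlongrightarrow> l0) at_top"
    using ne lim by blast
  have "\<forall>\<^sub>F t in at_top. (norm (x t - z0))\<^sup>2 < l0 + 1"
    by (rule order_tendstoD(2)[OF l0]) simp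
  then obtain N where N: "\<And>t. t \<ge> N \<Longrightarrow> (norm (x t - z0))\<^sup>2 < l0 + 1"
    by (auto simp: eventually_at_top_linorder)
  \<comment> \<open>The predicate \<open>P\<close> replaces the passage to a subsequence: tails are
    restricted to the times satisfying \<open>P\<close>, which occur arbitrarily late.\<close>
  have ex: "\<exists>w. \<forall>y c. (\<forall>\<^sub>F t in at_top. P t \<longrightarrow> inner (x t) y \<le> c) \<longrightarrow> inner w y \<le> c"
    if P: "\<exists>\<^sub>F t in at_top. P t" for P
  proof -
    define A where "A n = x ` {t. t \<ge> N + real n \<and> P t}" for n
    have "decseq A" by (auto simp: A_def decseq_def)
    moreover have "A n \<noteq> {}" for n
      using P frequently_eventually_frequently[OF P eventually_ge_at_top[of "N + real n"]]
      by (auto simp: A_def dest!: frequently_ex)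
    moreover have "bounded (A 0)"
    proof -
      have "dist z0 (x t) \<le> sqrt (l0 + 1)" if "t \<ge> N" for t
        using N[OF that] real_le_rsqrt less_imp_le by (metis dist_commute dist_norm)
      then have "A 0 \<subseteq> cball z0 (sqrt (l0 + 1))" by (auto simp: A_def)
      then show ?thesis using bounded_cball bounded_subset by blast
    qed
    ultimately obtain w where w: "\<And>n y c. (\<And>a. a \<in> A n \<Longrightarrow> inner a y \<le> c) \<Longrightarrow> inner w y \<le> c"
      using decreasing_bounded_halfspace_cluster_point[of A] by metis
    have "inner w y \<le> c" if ev: "\<forall>\<^sub>F t in at_top. P t \<longrightarrow> inner (x t) y \<le> c" for y c
    proof -
      obtain M where M: "\<And>t. t \<ge> M \<Longrightarrow> P t \<Longrightarrow> inner (x t) y \<le> c"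
        using ev by (auto simp: eventually_at_top_linorder)
      obtain n where "M - N \<le> real n" using real_arch_simple by blast
      then show ?thesis using M by (intro w[of n]) (auto simp: A_def)
    qed
    then show ?thesis by blast
  qed
  define H where "H w \<longleftrightarrow> (\<forall>y c. (\<forall>\<^sub>F t in at_top. inner (x t) y \<le> c) \<longrightarrow> inner w y \<le> c)" for w
  have HS: "w \<in> S" if "H w" for w
    by (rule cluster) (use that in \<open>simp add: H_def\<close>)
  \<comment> \<open>The difference of two squared distances is affine in \<open>x t\<close>, so
    \<open>inner (x t) (w1 - w2)\<close> has a limit \<open>L\<close>. Both points lie in the
    half-spaces with bounds \<open>L + e\<close> and \<open>L - e\<close>, so their inner products
    with \<open>w1 - w2\<close> agree.\<close>
  have uniq: "w1 = w2" if w: "H w1" "H w2" for w1 w2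
  proof -
    obtain l1 l2 where "((\<lambda>t. (norm (x t - w1))\<^sup>2) \<longlongrightarrow> l1) at_top" "((\<lambda>t. (norm (x t - w2))\<^sup>2) \<longlongrightarrow> l2) at_top"
      using lim HS w by meson
    then have "((\<lambda>t. ((norm (x t - w2))\<^sup>2 - (norm (x t - w1))\<^sup>2 + (norm w1)\<^sup>2 - (norm w2)\<^sup>2) / 2)
      \<longlongrightarrow> (l2 - l1 + (norm w1)\<^sup>2 - (norm w2)\<^sup>2) / 2) at_top"
      by (intro tendsto_intros) auto
    moreover have "((norm (x t - w2))\<^sup>2 - (norm (x t - w1))\<^sup>2 + (norm w1)\<^sup>2 - (norm w2)\<^sup>2) / 2 = inner (x t) (w1 - w2)" for t
      unfolding power2_norm_eq_inner
      by (simp add: inner_diff_left inner_diff_right inner_commute field_simps)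
    ultimately obtain L where L: "((\<lambda>t. inner (x t) (w1 - w2)) \<longlongrightarrow> L) at_top" by auto
    have "inner w (w1 - w2) = L" if "H w" for w
    proof (rule antisym; rule field_le_epsilon)
      fix e :: real assume "e > 0"
      have "\<forall>\<^sub>F t in at_top. inner (x t) (w1 - w2) < L + e"
        by (rule order_tendstoD(2)[OF L]) (simp add: \<open>e > 0\<close>)
      then have "\<forall>\<^sub>F t in at_top. inner (x t) (w1 - w2) \<le> L + e"
        by eventually_elim simp
      then show "inner w (w1 - w2) \<le> L + e" using that unfolding H_def by blast
      have "\<forall>\<^sub>F t in at_top. L - e < inner (x t) (w1 - w2)"
        by (rule order_tendstoD(1)[OF L]) (simp add: \<open>e > 0\<close>)
      then have "\<forall>\<^sub>F t in at_top. inner (x t) (- (w1 - w2)) \<le> e - L"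
        unfolding inner_minus_right by eventually_elim simp
      then have "inner w (- (w1 - w2)) \<le> e - L" using that unfolding H_def by blast
      then show "L \<le> inner w (w1 - w2) + e" unfolding inner_minus_right by simp
    qed
    then have "inner w1 (w1 - w2) = inner w2 (w1 - w2)" using w by simp
    then have "inner (w1 - w2) (w1 - w2) = 0" by (simp add: inner_diff_left)
    then show ?thesis by simp
  qed
  obtain w where w: "H w"
    using ex[of "\<lambda>_. True"] by (auto simp: H_def frequently_const)
  \<comment> \<open>Otherwise the trajectory returns arbitrarily late to the opposite closed
    half-space. A cluster point along those times equals \<open>w\<close> by uniqueness, yet lies in
    that half-space.\<close>
  have up: "\<forall>\<^sub>F t in at_top. inner (x t) y < inner w y + e" if "e > 0" for y e
  proof (rule ccontr)
    assume "\<not> (\<forall>\<^sub>F t in at_top. inner (x t) y < inner w y + e)"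
    then have fr: "\<exists>\<^sub>F t in at_top. inner w y + e \<le> inner (x t) y"
      by (simp add: not_eventually not_less)
    obtain w' where w': "\<And>v c. (\<forall>\<^sub>F t in at_top. inner w y + e \<le> inner (x t) y \<longrightarrow> inner (x t) v \<le> c) \<Longrightarrow> inner w' v \<le> c"
      using ex[OF fr] by blast
    have "H w'" unfolding H_def
    proof (intro allI impI)
      fix v c assume "\<forall>\<^sub>F t in at_top. inner (x t) v \<le> c"
      then have "\<forall>\<^sub>F t in at_top. inner w y + e \<le> inner (x t) y \<longrightarrow> inner (x t) v \<le> c"
        by eventually_elim simp
      then show "inner w' v \<le> c" by (rule w')
    qed
    then have "w' = w" using uniq w by blast
    moreover have "inner w' (- y) \<le> - (inner w y + e)"
      by (rule w') simp
    ultimately show False using \<open>e > 0\<close> by simp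
  qed
  have "((\<lambda>t. inner (x t) y) \<longlongrightarrow> inner w y) at_top" for y
  proof (rule tendstoI)
    fix e :: real assume "e > 0"
    show "\<forall>\<^sub>F t in at_top. dist (inner (x t) y) (inner w y) < e"
      using up[OF \<open>e > 0\<close>, of y] up[OF \<open>e > 0\<close>, of "- y"]
      by eventually_elim (auto simp: dist_real_def)
  qed
  then show ?thesis using HS[OF w] unfolding weakly_tendsto_def by blast
qed

subsection \<open>The Lyapunov analysis\<close>

lemma norm_sq_linear_combination:
  fixes u v :: "'a::real_inner"
  shows "(norm (a *\<^sub>R u + b *\<^sub>R v))\<^sup>2 = a\<^sup>2 * (norm u)\<^sup>2 + 2 * (a * b * inner u v) + b\<^sup>2 * (norm v)\<^sup>2"
  unfolding power2_norm_eq_inner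
  by (simp add: inner_add_left inner_add_right inner_commute[of v u] power2_eq_square algebra_simps)

section \<open>Limits and integrals from scalar decay\<close>

lemma nonincreasing_bounded_below_tendsto:
  fixes E :: "real \<Rightarrow> real"
  assumes mono: "\<And>s t. \<lbrakk>T \<le> s; s \<le> t\<rbrakk> \<Longrightarrow> E t \<le> E s" and lb: "\<And>t. t \<ge> T \<Longrightarrow> B \<le> E t"
  obtains L where "(E \<longlongrightarrow> L) at_top"
proof (rule that, rule order_tendstoI)
  define L where "L = (INF t\<in>{T..}. E t)"
  have bb: "bdd_below (E ` {T..})" using lb by (intro bdd_belowI2[where m=B]) auto
  show "\<forall>\<^sub>F t in at_top. a < E t" if "a < L" for a
    using eventually_ge_at_top[of T]
  proof eventually_elim
    case (elim t)
    have "L \<le> E t" unfolding L_def using bb elim by (intro cINF_lower) auto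
    with that show ?case by simp
  qed
  show "\<forall>\<^sub>F t in at_top. E t < a" if a: "L < a" for a
  proof -
    obtain s where "s \<ge> T" "E s < a"
      using a cINF_less_iff[OF _ bb] unfolding L_def by auto
    show ?thesis using eventually_ge_at_top[of s]
      by eventually_elim (use mono \<open>s \<ge> T\<close> \<open>E s < a\<close> in fastforce)
  qed
qed

text \<open>With \<open>H\<close> the integral of \<open>h\<close> from \<open>T\<close>, the
  function \<open>E + c * H\<close> is nonincreasing, so \<open>E T / c\<close> bounds all later
  integrals; continuity covers the stretch from \<open>t0\<close> to \<open>T\<close>. A single term
  of the dissipation can serve as \<open>h\<close>.\<close>

lemma set_integrable_dissipation:
  fixes E h :: "real \<Rightarrow> real"
  assumes cont: "continuous_on {t0..} h" and nonneg: "\<And>t. t \<ge> t0 \<Longrightarrow> 0 \<le> h t"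
    and "t0 \<le> T" and E: "\<And>t. t \<ge> T \<Longrightarrow> 0 \<le> E t" and "c > 0"
    and D: "\<And>t. t \<ge> T \<Longrightarrow> \<exists>D. (E has_real_derivative D) (at t) \<and> D \<le> - c * h t"
  shows "set_integrable lborel {t0..} h"
proof -
  have int: "h integrable_on {a..b}" if "t0 \<le> a" for a b
    using that by (intro integrable_continuous_real continuous_on_subset[OF cont]) auto
  have le: "integral {T..S} h \<le> E T / c" if "T \<le> S" for S
  proof -
    define H where "H u = integral {T..u} h" for u
    have H: "(H has_vector_derivative h t) (at t within {T..S})" if "t \<in> {T..S}" for t
      unfolding H_def using that \<open>t0 \<le> T\<close>
      by (intro integral_has_vector_derivative continuous_on_subset[OF cont]) auto
    have "- E T - c * H T \<le> - E S - c * H S"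
    proof (rule DERIV_nonneg_imp_increasing_open[OF \<open>T \<le> S\<close>])
      fix t assume t: "T < t" "t < S"
      have "(H has_vector_derivative h t) (at t within {T..S})" using H t by simp
      then have "(H has_real_derivative h t) (at t)"
        using t by (simp add: has_real_derivative_iff_has_vector_derivative at_within_Icc_at)
      moreover obtain D' where "(E has_real_derivative D') (at t)" "D' \<le> - c * h t"
        using D t by (meson less_imp_le)
      ultimately show "\<exists>y. ((\<lambda>t. - E t - c * H t) has_real_derivative y) (at t) \<and> 0 \<le> y"
        by (intro exI[of _ "- D' - c * h t"]) (auto intro!: derivative_eq_intros)
    next
      have "continuous_on {T..S} H"
        using H by (meson continuous_on_vector_derivative)
      moreover have "continuous_on {T..S} E"
        using D by (meson DERIV_isCont atLeastAtMost_iff continuous_at_imp_continuous_on)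
      ultimately show "continuous_on {T..S} (\<lambda>t. - E t - c * H t)"
        by (intro continuous_intros)
    qed
    moreover have "H T = 0" by (simp add: H_def)
    ultimately have "c * H S \<le> E T" using E[OF \<open>T \<le> S\<close>] by simp
    then show ?thesis using \<open>c > 0\<close> by (simp add: H_def field_simps)
  qed
  define F where "F u = integral {t0..u} h" for u
  have F_split: "F v = F u + integral {u..v} h" if "t0 \<le> u" "u \<le> v" for u v
    unfolding F_def using that Henstock_Kurzweil_Integration.integral_combine[OF that int[of t0 v]] by simp
  have "F u \<le> F v" if "t0 \<le> u" "u \<le> v" for u v
    using F_split[OF that] integral_nonneg[OF int[of u v]] nonneg that by force
  moreover have "F v \<le> F T + E T / c" if "t0 \<le> v" for v
  proof (cases "T \<le> v")
    case True
    then show ?thesis using F_split[OF \<open>t0 \<le> T\<close> True] le by simp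
  next
    case False
    then show ?thesis using calculation[OF that, of T] E[of T] \<open>c > 0\<close> by (simp add: add_increasing2)
  qed
  ultimately obtain L where "((\<lambda>u. - F u) \<longlongrightarrow> L) at_top"
    using nonincreasing_bounded_below_tendsto[of t0 "\<lambda>u. - F u" "- (F T + E T / c)"]
    by (metis neg_le_iff_le)
  from tendsto_minus[OF this] have L: "(F \<longlongrightarrow> - L) at_top" by simp
  have si: "set_integrable lborel {t0..y} h" for y
    by (intro borel_integrable_atLeastAtMost' continuous_on_subset[OF cont]) auto
  \<comment> \<open>Truncation at \<open>y\<close>, in the shape required by monotone convergence
    along growing half-lines.\<close>
  have eq: "indicator {t0..} t *\<^sub>R h t * indicator {..y} t = indicator {t0..y} t *\<^sub>R h t" for t y
    by (auto simp: indicator_def)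
  have Feq: "(\<integral>t. indicator {t0..} t *\<^sub>R h t * indicator {..y} t \<partial>lborel) = F y" for y
    unfolding eq F_def using set_borel_integral_eq_integral(2)[OF si] by (simp add: set_lebesgue_integral_def)
  show ?thesis
    unfolding set_integrable_def
  proof (rule integrable_monotone_convergence_at_top)
    show "(\<lambda>t. indicator {t0..} t *\<^sub>R h t) \<in> borel_measurable borel"
      by (rule borel_measurable_continuous_on_indicator[OF _ cont]) simp
    show "integrable lborel (\<lambda>t. indicator {t0..} t *\<^sub>R h t * indicator {..y} t)" for y
      unfolding eq using si by (simp add: set_integrable_def)
    show "((\<lambda>y. \<integral>t. indicator {t0..} t *\<^sub>R h t * indicator {..y} t \<partial>lborel) \<longlongrightarrow> - L) at_top"
      unfolding Feq by (rule L)
  qed (auto simp: indicator_def nonneg)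
qed

text \<open>A positive limit would make \<open>E + b * ln t\<close> nonincreasing for large
  \<open>t\<close>, with \<open>b = c * l / 2\<close>, although \<open>E\<close> is nonnegative and
  the logarithm is unbounded.\<close>

lemma dissipation_limit_zero:
  fixes E h :: "real \<Rightarrow> real"
  assumes lim: "(h \<longlongrightarrow> l) at_top" and h: "\<And>t. t \<ge> T \<Longrightarrow> 0 \<le> h t"
    and E: "\<And>t. t \<ge> T \<Longrightarrow> 0 \<le> E t" and "c > 0"
    and D: "\<And>t. t \<ge> T \<Longrightarrow> \<exists>D. (E has_real_derivative D) (at t) \<and> D \<le> - c * (h t / t)"
  shows "l = 0"
proof (rule ccontr)
  assume "l \<noteq> 0"
  moreover have "0 \<le> l"
  proof -
    have "\<forall>\<^sub>F t in at_top. 0 \<le> h t"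
      using eventually_ge_at_top[of T] by eventually_elim (rule h)
    then show ?thesis using tendsto_lowerbound[OF lim] by simp
  qed
  ultimately have "l > 0" by simp
  have "\<forall>\<^sub>F t in at_top. l / 2 < h t"
    by (rule order_tendstoD(1)[OF lim]) (use \<open>l > 0\<close> in simp)
  then obtain N where N: "\<And>t. t \<ge> N \<Longrightarrow> l / 2 < h t"
    by (auto simp: eventually_at_top_linorder)
  define R where "R = max N (max T 1)"
  define b where "b = c * l / 2"
  have "b > 0" using \<open>c > 0\<close> \<open>l > 0\<close> by (simp add: b_def)
  have mono: "E t + b * ln t \<le> E R + b * ln R" if "R \<le> t" for t
  proof (rule DERIV_nonpos_imp_nonincreasing[OF that])
    fix s assume s: "R \<le> s" "s \<le> t"
    then have s': "s \<ge> T" "s \<ge> 1" "s \<ge> N" by (auto simp: R_def)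
    obtain D' where D': "(E has_real_derivative D') (at s)" "D' \<le> - c * (h s / s)"
      using D[OF s'(1)] by blast
    have "l / 2 * c \<le> h s * c"
      using N[OF s'(3)] \<open>c > 0\<close> by (intro mult_right_mono) auto
    then have "b / s \<le> c * (h s / s)"
      using s' divide_right_mono[of b "c * h s" s] by (simp add: b_def mult.commute)
    then have "D' + b * (1 / s) \<le> 0" using D'(2) by simp
    moreover have "((\<lambda>t. E t + b * ln t) has_real_derivative D' + b * (1 / s)) (at s)"
      using D'(1) s' by (auto intro!: derivative_eq_intros)
    ultimately show "\<exists>y. ((\<lambda>t. E t + b * ln t) has_real_derivative y) (at s) \<and> y \<le> 0" by blast
  qed
  \<comment> \<open>Nonnegativity of \<open>E\<close> bounds \<open>ln t\<close> by
    \<open>M\<close>, while the time chosen next has logarithm at least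
    \<open>M + 1\<close>.\<close>
  define M where "M = (E R + b * ln R) / b"
  define t where "t = max R (exp (M + 1))"
  have "t > 0" "R \<le> t" "T \<le> t" by (auto simp: t_def R_def)
  have "M + 1 \<le> ln t"
    using \<open>t > 0\<close> by (simp add: ln_ge_iff t_def)
  moreover have "b * ln t \<le> b * M"
    using mono[OF \<open>R \<le> t\<close>] E[OF \<open>T \<le> t\<close>] \<open>b > 0\<close> by (simp add: M_def)
  ultimately show False using \<open>b > 0\<close> by simp
qed

text \<open>The hypotheses at infinity become inequalities valid from one time \<open>T\<close> on:
  \<open>c\<close> is a lower bound from (a), \<open>K\<close> the constant in (b),
  \<open>\<zeta>\<close> the slack in (d). The derivative of \<open>p\<close> is assumed at every
  such time, which keeps the Lyapunov analysis free of exceptional sets; \<open>T \<ge> 1\<close>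
  allows powers of \<open>t\<close> to be compared.\<close>

locale inertial_trajectory = moreau f
  for f :: "'a::{real_inner, banach} \<Rightarrow> ereal" +
  fixes \<alpha> \<beta> :: real and \<delta> \<delta>' \<gamma> \<gamma>' :: "real \<Rightarrow> real" and x x' p :: "real \<Rightarrow> 'a" and T \<zeta> c K :: real
  assumes \<alpha>: "\<alpha> > 3" and \<beta>: "\<beta> > 0" and T: "T \<ge> 1" and \<zeta>: "0 < \<zeta>" "\<zeta> \<le> \<alpha> - 3" and c: "c > 0"
    and \<delta>_pos: "\<And>t. t \<ge> T \<Longrightarrow> \<delta> t > 0" and \<gamma>_pos: "\<And>t. t \<ge> T \<Longrightarrow> \<gamma> t > 0"
    and \<delta>_deriv: "\<And>t. t \<ge> T \<Longrightarrow> (\<delta> has_real_derivative \<delta>' t) (at t)"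
    and \<gamma>_deriv: "\<And>t. t \<ge> T \<Longrightarrow> (\<gamma> has_real_derivative \<gamma>' t) (at t)"
    and x_deriv: "\<And>t. t \<ge> T \<Longrightarrow> (x has_vector_derivative x' t) (at t)"
    and p: "\<And>t. t \<ge> T \<Longrightarrow> p t = x' t + (\<beta> * \<delta> t) *\<^sub>R grad (\<gamma> t) (x t)"
    and p_deriv: "\<And>t. t \<ge> T \<Longrightarrow>
      (p has_vector_derivative - ((\<alpha> / t) *\<^sub>R x' t + ((1 + \<beta> / t) * \<delta> t) *\<^sub>R grad (\<gamma> t) (x t))) (at t)"
    and \<delta>_growth: "\<And>t. t \<ge> T \<Longrightarrow> 0 \<le> \<delta>' t" "\<And>t. t \<ge> T \<Longrightarrow> t * \<delta>' t \<le> (\<alpha> - 3 - \<zeta>) * \<delta> t"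
    and \<gamma>_growth: "\<And>t. t \<ge> T \<Longrightarrow> c * (t * \<delta> t) \<le> \<gamma>' t"
    and \<delta>_le_\<gamma>: "\<And>t. t \<ge> T \<Longrightarrow> t\<^sup>2 * \<delta> t \<le> K * \<gamma> t"
begin

section \<open>Derivative and decay of the energy\<close>

abbreviation g :: "real \<Rightarrow> 'a" where "g t \<equiv> grad (\<gamma> t) (x t)"
definition \<phi> :: "real \<Rightarrow> real" where "\<phi> t = env (\<gamma> t) (x t) - min_value f"
text \<open>The vector \<open>(\<alpha> - 1 - k) (x - z) + t p\<close> has derivative
  \<open>- k x' - t \<delta> g\<close>. The remaining weights are dictated by cancellation in the
  derivative: the second term removes the inner product of \<open>x - z\<close> and
  \<open>x'\<close>, and the factor \<open>t\<^sup>2 + \<beta> * k * t\<close> removes that of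
  \<open>g\<close> and \<open>x'\<close>.\<close>

definition energy :: "real \<Rightarrow> 'a \<Rightarrow> real \<Rightarrow> real" where
  "energy k z t = (norm ((\<alpha> - 1 - k) *\<^sub>R (x t - z) + t *\<^sub>R p t))\<^sup>2 / 2
     + (\<alpha> - 1 - k) * k / 2 * (norm (x t - z))\<^sup>2 + (t\<^sup>2 + \<beta> * k * t) * \<delta> t * \<phi> t"
definition dissipation :: "real \<Rightarrow> real" where
  "dissipation t = t * \<delta> t * \<phi> t + t * (norm (x' t))\<^sup>2 + t ^ 3 * (\<delta> t)\<^sup>2 * (norm (g t))\<^sup>2"

lemma \<phi>_nonneg: "t \<ge> T \<Longrightarrow> 0 \<le> \<phi> t"
  unfolding \<phi>_def using env_ge_min_value[OF \<gamma>_pos] by simp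

lemma energy_has_derivative:
  assumes t: "t \<ge> T"
  shows "(energy k z has_real_derivative
    - ((\<alpha> - 1 - k) * t * \<delta> t * inner (x t - z) (g t)) - k * t * (norm (x' t))\<^sup>2 - t\<^sup>2 * \<beta> * (\<delta> t)\<^sup>2 * (norm (g t))\<^sup>2
    + ((2 * t + \<beta> * k) * \<delta> t + (t\<^sup>2 + \<beta> * k * t) * \<delta>' t) * \<phi> t
    - (t\<^sup>2 + \<beta> * k * t) * \<delta> t * \<gamma>' t / 2 * (norm (g t))\<^sup>2) (at t)"
proof -
  define l where "l = \<alpha> - 1 - k"
  have t0: "t > 0" using t T by simp
  define w where "w = - (k *\<^sub>R x' t + (t * \<delta> t) *\<^sub>R g t)"
  have x: "(x has_vector_derivative x' t) (at t)" by (rule x_deriv[OF t])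
  have v: "((\<lambda>t. l *\<^sub>R (x t - z) + t *\<^sub>R p t) has_vector_derivative w) (at t)"
  proof -
    have "((\<lambda>t. l *\<^sub>R (x t - z) + t *\<^sub>R p t) has_vector_derivative
        l *\<^sub>R (x' t - 0) + (t *\<^sub>R - ((\<alpha> / t) *\<^sub>R x' t + ((1 + \<beta> / t) * \<delta> t) *\<^sub>R g t) + 1 *\<^sub>R p t)) (at t)"
      by (intro has_vector_derivative_add has_vector_derivative_scaleR has_vector_derivative_diff
          bounded_linear.has_vector_derivative[OF bounded_linear_scaleR_right]
          has_vector_derivative_const x p_deriv[OF t] DERIV_ident)
    moreover have "l *\<^sub>R (x' t - 0) + (t *\<^sub>R - ((\<alpha> / t) *\<^sub>R x' t + ((1 + \<beta> / t) * \<delta> t) *\<^sub>R g t) + 1 *\<^sub>R p t) = w"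
    proof -
      have "t *\<^sub>R - ((\<alpha> / t) *\<^sub>R x' t + ((1 + \<beta> / t) * \<delta> t) *\<^sub>R g t) = - (\<alpha> *\<^sub>R x' t + ((t + \<beta>) * \<delta> t) *\<^sub>R g t)"
      proof -
        have "t * (\<alpha> / t) = \<alpha>" "t * ((1 + \<beta> / t) * \<delta> t) = (t + \<beta>) * \<delta> t"
          using t0 by (simp_all add: field_simps)
        then show ?thesis unfolding scaleR_minus_right scaleR_add_right scaleR_scaleR by simp
      qed
      then show ?thesis
        unfolding w_def p[OF t] l_def by (simp add: algebra_simps)
    qed
    ultimately show ?thesis by simp
  qed
  have sq: "((\<lambda>t. (norm (u t))\<^sup>2) has_real_derivative 2 * inner (u t) d) (at t)"
    if "(u has_vector_derivative d) (at t)" for u :: "real \<Rightarrow> 'a" and d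
  proof -
    have "((\<lambda>t. inner (u t) (u t)) has_vector_derivative inner (u t) d + inner d (u t)) (at t)"
      by (rule bounded_bilinear.has_vector_derivative[OF bounded_bilinear_inner that that])
    then show ?thesis
      by (simp add: power2_norm_eq_inner has_real_derivative_iff_has_vector_derivative inner_commute)
  qed
  have xz: "((\<lambda>t. x t - z) has_vector_derivative x' t) (at t)"
    using has_vector_derivative_diff[OF x has_vector_derivative_const[of z]] by simp
  have \<phi>': "(\<phi> has_real_derivative inner (g t) (x' t) - \<gamma>' t / 2 * (norm (g t))\<^sup>2) (at t)"
    unfolding \<phi>_def using DERIV_diff[OF env_has_real_derivative_along[OF \<gamma>_deriv[OF t] x \<gamma>_pos[OF t]] DERIV_const[of "min_value f"]]
    by simp
  have deriv: "((\<lambda>t. (norm (l *\<^sub>R (x t - z) + t *\<^sub>R p t))\<^sup>2 / 2 + l * k / 2 * (norm (x t - z))\<^sup>2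
      + (t\<^sup>2 + \<beta> * k * t) * \<delta> t * \<phi> t) has_real_derivative
      2 * inner (l *\<^sub>R (x t - z) + t *\<^sub>R p t) w / 2 + l * k / 2 * (2 * inner (x t - z) (x' t))
      + (((2 * t + \<beta> * k) * \<delta> t + (t\<^sup>2 + \<beta> * k * t) * \<delta>' t) * \<phi> t
        + (t\<^sup>2 + \<beta> * k * t) * \<delta> t * (inner (g t) (x' t) - \<gamma>' t / 2 * (norm (g t))\<^sup>2))) (at t)"
  proof -
    have "((\<lambda>t. t\<^sup>2 + \<beta> * k * t) has_real_derivative 2 * t + \<beta> * k) (at t)"
      by (auto intro!: derivative_eq_intros)
    from DERIV_add[OF DERIV_add[OF DERIV_cdivide[OF sq[OF v], of 2] DERIV_cmult[OF sq[OF xz], of "l * k / 2"]]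
        DERIV_mult[OF DERIV_mult[OF this \<delta>_deriv[OF t]] \<phi>']]
    show ?thesis by (rule DERIV_cong) (simp add: algebra_simps)
  qed
  have inner_w: "inner (l *\<^sub>R (x t - z) + t *\<^sub>R p t) w = - (k * l * inner (x t - z) (x' t)) - l * t * \<delta> t * inner (x t - z) (g t)
    - k * t * (norm (x' t))\<^sup>2 - t\<^sup>2 * \<delta> t * inner (g t) (x' t) - t * \<beta> * \<delta> t * k * inner (g t) (x' t)
    - t\<^sup>2 * \<beta> * (\<delta> t)\<^sup>2 * (norm (g t))\<^sup>2"
    unfolding w_def p[OF t] power2_norm_eq_inner
    by (simp add: inner_add_left inner_add_right inner_commute[of "x' t" "g t"] algebra_simps power2_eq_square)
  have "energy k z = (\<lambda>t. (norm (l *\<^sub>R (x t - z) + t *\<^sub>R p t))\<^sup>2 / 2 + l * k / 2 * (norm (x t - z))\<^sup>2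
      + (t\<^sup>2 + \<beta> * k * t) * \<delta> t * \<phi> t)"
    by (rule ext) (simp only: energy_def l_def)
  then show ?thesis
    using deriv unfolding inner_w l_def[symmetric]
    by (elim ssubst DERIV_cong) (simp add: field_simps power2_eq_square)
qed

lemma energy_nonneg:
  assumes "0 < k" "k < \<zeta>" "t \<ge> T"
  shows "(\<alpha> - 1 - k) * k / 2 * (norm (x t - z))\<^sup>2 \<le> energy k z t" "t\<^sup>2 * \<delta> t * \<phi> t \<le> energy k z t" "0 \<le> energy k z t"
proof -
  have \<delta>: "\<delta> t * \<phi> t \<ge> 0" using \<delta>_pos \<phi>_nonneg assms(3) by (simp add: less_imp_le)
  have 1: "0 \<le> (norm ((\<alpha> - 1 - k) *\<^sub>R (x t - z) + t *\<^sub>R p t))\<^sup>2 / 2" by simp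
  have 2: "0 \<le> (\<alpha> - 1 - k) * k / 2 * (norm (x t - z))\<^sup>2" using assms \<zeta> by simp
  have 3: "0 \<le> t\<^sup>2 * (\<delta> t * \<phi> t)" using \<delta> by simp
  have 4: "0 \<le> \<beta> * k * t * (\<delta> t * \<phi> t)" using \<delta> \<beta> assms T by simp
  have eq: "(t\<^sup>2 + \<beta> * k * t) * \<delta> t * \<phi> t = t\<^sup>2 * (\<delta> t * \<phi> t) + \<beta> * k * t * (\<delta> t * \<phi> t)"
    by (simp add: algebra_simps)
  show "(\<alpha> - 1 - k) * k / 2 * (norm (x t - z))\<^sup>2 \<le> energy k z t" "0 \<le> energy k z t"
    unfolding energy_def eq using 1 2 3 4 by linarith+
  show "t\<^sup>2 * \<delta> t * \<phi> t \<le> energy k z t"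
    unfolding energy_def eq mult.assoc[of "t\<^sup>2"] using 1 2 3 4 by linarith
qed

text \<open>Relative to \<open>t \<delta> \<phi>\<close>, the weight of the gap grows to leading
  order by at most \<open>\<alpha> - 1 - \<zeta>\<close>, by (d), while convexity pays
  \<open>\<alpha> - 1 - k\<close>. The surplus is \<open>\<zeta> - k\<close>; the terms with
  \<open>\<beta> k\<close> are of lower order in \<open>t\<close>.\<close>

lemma energy_decay:
  assumes k: "0 < k" "k < \<zeta>" and z: "z \<in> argmin f"
  obtains R b where "R \<ge> T" "b > 0"
    "\<And>t. t \<ge> R \<Longrightarrow> \<exists>D. (energy k z has_real_derivative D) (at t) \<and> D \<le> - b * dissipation t"
proof -
  \<comment> \<open>One constant for three terms: half of the surplus for the gap, \<open>k\<close>
    for the velocity, \<open>c / 2\<close> for the gradient. From \<open>R\<close> on, the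
    lower-order terms consume at most the other half of the surplus.\<close>
  define b where "b = min ((\<zeta> - k) / 2) (min k (c / 2))"
  define R where "R = max T (2 * (\<beta> * k * (\<alpha> - 2 - \<zeta>)) / (\<zeta> - k))"
  have "b > 0" using k c by (simp add: b_def)
  have "\<exists>D. (energy k z has_real_derivative D) (at t) \<and> D \<le> - b * dissipation t" if "t \<ge> R" for t
  proof -
    have t: "t \<ge> T" "t \<ge> 1" using that T by (auto simp: R_def)
    have R: "\<beta> * k * (\<alpha> - 2 - \<zeta>) \<le> (\<zeta> - k) / 2 * t"
      using that k by (simp add: R_def field_simps)
    have \<delta>: "\<delta> t > 0" and \<gamma>: "\<gamma> t > 0" and \<phi>: "\<phi> t \<ge> 0" using t \<delta>_pos \<gamma>_pos \<phi>_nonneg by auto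
    define X N Q where "X = inner (x t - z) (g t)" and "N = (norm (x' t))\<^sup>2" and "Q = (norm (g t))\<^sup>2"
    have NQ: "N \<ge> 0" "Q \<ge> 0" by (simp_all add: N_def Q_def)
    have "0 \<le> \<gamma> t / 2 * Q" using \<gamma> NQ by simp
    then have "\<phi> t \<le> X"
      using grad_coercive[OF \<gamma> z, of "x t"] by (simp add: \<phi>_def X_def Q_def)
    then have 1: "(\<alpha> - 1 - k) * t * \<delta> t * \<phi> t \<le> (\<alpha> - 1 - k) * t * \<delta> t * X"
      using t \<delta> k \<zeta> by (intro mult_left_mono) auto
    have "(t + \<beta> * k) * (t * \<delta>' t) \<le> (t + \<beta> * k) * ((\<alpha> - 3 - \<zeta>) * \<delta> t)"
      using \<delta>_growth(2)[OF t(1)] t k \<beta> by (intro mult_left_mono) auto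
    then have "(2 * t + \<beta> * k) * \<delta> t + (t\<^sup>2 + \<beta> * k * t) * \<delta>' t - (\<alpha> - 1 - k) * t * \<delta> t
        \<le> \<delta> t * (\<beta> * k * (\<alpha> - 2 - \<zeta>) - (\<zeta> - k) * t)"
      by (simp add: algebra_simps power2_eq_square)
    also have "\<dots> \<le> \<delta> t * (- ((\<zeta> - k) / 2 * t))"
      using R \<delta> by (intro mult_left_mono) auto
    also have "\<dots> \<le> \<delta> t * (- (b * t))"
    proof -
      have "b \<le> (\<zeta> - k) / 2" unfolding b_def by (rule min.cobounded1)
      then have "b * t \<le> (\<zeta> - k) / 2 * t" using t by (intro mult_right_mono) auto
      then show ?thesis using \<delta> by (intro mult_left_mono) auto
    qed
    finally have 2: "((2 * t + \<beta> * k) * \<delta> t + (t\<^sup>2 + \<beta> * k * t) * \<delta>' t - (\<alpha> - 1 - k) * t * \<delta> t) * \<phi> t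
        \<le> \<delta> t * (- (b * t)) * \<phi> t"
      using \<phi> by (rule mult_right_mono)
    have 3: "b * (t * N) \<le> k * (t * N)"
      using t NQ by (intro mult_right_mono) (auto simp: b_def)
    \<comment> \<open>The damping term with \<open>t\<^sup>2 * \<beta>\<close> has one power of
      \<open>t\<close> too few; the cubic weight comes from the growth of \<open>\<gamma>\<close>,
      which lowers the envelope.\<close>
    have 4: "b * (t ^ 3 * (\<delta> t)\<^sup>2 * Q) \<le> (t\<^sup>2 + \<beta> * k * t) * \<delta> t * \<gamma>' t / 2 * Q"
    proof -
      have "b * (t ^ 3 * (\<delta> t)\<^sup>2 * Q) \<le> c / 2 * (t ^ 3 * (\<delta> t)\<^sup>2 * Q)"
        using t NQ by (intro mult_right_mono) (auto simp: b_def)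
      also have "\<dots> = t\<^sup>2 * \<delta> t * (c * (t * \<delta> t)) / 2 * Q"
        by (simp add: power2_eq_square power3_eq_cube)
      also have "\<dots> \<le> (t\<^sup>2 + \<beta> * k * t) * \<delta> t * \<gamma>' t / 2 * Q"
        using t \<delta> \<beta> k c NQ \<gamma>_growth[OF t(1)]
        by (intro mult_right_mono divide_right_mono mult_mono) auto
      finally show ?thesis .
    qed
    have 5: "0 \<le> t\<^sup>2 * \<beta> * (\<delta> t)\<^sup>2 * Q" using \<beta> NQ by simp
    show ?thesis
    proof (intro exI conjI)
      show "- ((\<alpha> - 1 - k) * t * \<delta> t * inner (x t - z) (g t)) - k * t * (norm (x' t))\<^sup>2 - t\<^sup>2 * \<beta> * (\<delta> t)\<^sup>2 * (norm (g t))\<^sup>2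
        + ((2 * t + \<beta> * k) * \<delta> t + (t\<^sup>2 + \<beta> * k * t) * \<delta>' t) * \<phi> t
        - (t\<^sup>2 + \<beta> * k * t) * \<delta> t * \<gamma>' t / 2 * (norm (g t))\<^sup>2 \<le> - b * dissipation t"
        unfolding dissipation_def N_def[symmetric] Q_def[symmetric] X_def[symmetric]
        using 1 2 3 4 5 unfolding distrib_left left_diff_distrib mult_minus_left mult_minus_right by (simp add: mult.commute mult.left_commute) 
    qed (rule energy_has_derivative[OF t(1)])
  qed
  then show ?thesis using that[of R b] \<open>b > 0\<close> by (auto simp: R_def)
qed

lemma dissipation_terms_nonneg:
  assumes "t \<ge> T"
  shows "0 \<le> t * \<delta> t * \<phi> t" "0 \<le> t * (norm (x' t))\<^sup>2" "0 \<le> t ^ 3 * (\<delta> t)\<^sup>2 * (norm (g t))\<^sup>2"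
  using assms T \<delta>_pos[OF assms] \<phi>_nonneg[OF assms] by auto

lemma dissipation_nonneg: "t \<ge> T \<Longrightarrow> 0 \<le> dissipation t"
  using dissipation_terms_nonneg[of t] by (simp add: dissipation_def)

lemma energy_nonincreasing:
  assumes k: "0 < k" "k < \<zeta>" and z: "z \<in> argmin f"
  obtains R where "R \<ge> T" "\<And>s t. \<lbrakk>R \<le> s; s \<le> t\<rbrakk> \<Longrightarrow> energy k z t \<le> energy k z s"
proof -
  obtain R b where R: "R \<ge> T" "b > 0"
    "\<And>t. t \<ge> R \<Longrightarrow> \<exists>D. (energy k z has_real_derivative D) (at t) \<and> D \<le> - b * dissipation t"
    by (rule energy_decay[OF k z]) blast
  have "energy k z t \<le> energy k z s" if "R \<le> s" "s \<le> t" for s t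
  proof (rule DERIV_nonpos_imp_nonincreasing[OF that(2)])
    fix r assume "s \<le> r" "r \<le> t"
    then have r: "r \<ge> R" "r \<ge> T" using that R(1) by auto
    have "0 \<le> b * dissipation r" using R(2) dissipation_nonneg[OF r(2)] by simp
    then show "\<exists>y. (energy k z has_real_derivative y) (at r) \<and> y \<le> 0"
      using R(3)[OF r(1)] by force
  qed
  then show ?thesis using that R(1) by blast
qed

section \<open>Boundedness and limits along the trajectory\<close>

lemma energy_tendsto:
  assumes k: "0 < k" "k < \<zeta>" and z: "z \<in> argmin f"
  obtains L where "(energy k z \<longlongrightarrow> L) at_top"
proof -
  obtain R where R: "R \<ge> T" "\<And>s t. \<lbrakk>R \<le> s; s \<le> t\<rbrakk> \<Longrightarrow> energy k z t \<le> energy k z s"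
    by (rule energy_nonincreasing[OF k z]) blast
  show ?thesis
    by (rule nonincreasing_bounded_below_tendsto[of R "energy k z" 0])
      (use R energy_nonneg(3)[OF k] that in auto)
qed

lemma bounded_trajectory:
  assumes z: "z \<in> argmin f"
  obtains B where "\<forall>\<^sub>F t in at_top. norm (x t - z) \<le> B" "\<forall>\<^sub>F t in at_top. t\<^sup>2 * \<delta> t * \<phi> t \<le> B"
proof -
  define k where "k = \<zeta> / 2"
  have k: "0 < k" "k < \<zeta>" using \<zeta> by (auto simp: k_def)
  obtain R where R: "R \<ge> T" "\<And>s t. \<lbrakk>R \<le> s; s \<le> t\<rbrakk> \<Longrightarrow> energy k z t \<le> energy k z s"
    by (rule energy_nonincreasing[OF k z]) blast
  define a where "a = (\<alpha> - 1 - k) * k / 2"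
  have "a > 0" using k \<zeta> by (simp add: a_def)
  define e where "e = energy k z R"
  show ?thesis
  \<comment> \<open>One bound serves both claims; \<open>e / a + 1\<close> dominates the norm
    because \<open>2 s \<le> s^2 + 1\<close>.\<close>
  proof (rule that[of "max e (e / a + 1)"])
    show "\<forall>\<^sub>F t in at_top. norm (x t - z) \<le> max e (e / a + 1)"
      using eventually_ge_at_top[of R]
    proof eventually_elim
      case (elim t)
      have "a * (norm (x t - z))\<^sup>2 \<le> e"
        using energy_nonneg(1)[OF k, of t z] R(2)[of R t] R(1) elim by (simp add: a_def e_def)
      then have "(norm (x t - z))\<^sup>2 \<le> e / a" using \<open>a > 0\<close> by (simp add: field_simps)
      moreover have "0 \<le> (norm (x t - z) - 1)\<^sup>2" by simp
      then have "2 * norm (x t - z) \<le> (norm (x t - z))\<^sup>2 + 1" by (simp add: power2_diff)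
      ultimately show ?case using norm_ge_zero[of "x t - z"] by linarith
    qed
    show "\<forall>\<^sub>F t in at_top. t\<^sup>2 * \<delta> t * \<phi> t \<le> max e (e / a + 1)"
      using eventually_ge_at_top[of R]
    proof eventually_elim
      case (elim t)
      show ?case
        using energy_nonneg(2)[OF k, of t z] R(2)[of R t] R(1) elim by (simp add: e_def)
    qed
  qed
qed

text \<open>The same quantity with one more power of \<open>t\<close> is bounded. Hence the part of
  the energy with weight \<open>\<beta> * k * t\<close> disappears in every limit.\<close>

lemma \<delta>\<phi>_t_tendsto: "((\<lambda>t. t * \<delta> t * \<phi> t) \<longlongrightarrow> 0) at_top"
proof -
  obtain z where "z \<in> argmin f" using argmin by blast
  then obtain B where B: "\<forall>\<^sub>F t in at_top. t\<^sup>2 * \<delta> t * \<phi> t \<le> B"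
    by (rule bounded_trajectory)
  have "((\<lambda>t. B / t) \<longlongrightarrow> 0) at_top"
    by (intro tendsto_divide_0[OF tendsto_const] filterlim_at_top_imp_at_infinity filterlim_ident)
  moreover have "\<forall>\<^sub>F t in at_top. norm (t * \<delta> t * \<phi> t) \<le> B / t"
    using B eventually_ge_at_top[of T]
  proof eventually_elim
    case (elim t)
    then have "t > 0" using T by simp
    then have "t * \<delta> t * \<phi> t \<le> B / t"
      using elim(1) by (simp add: field_simps power2_eq_square)
    then show ?case using dissipation_terms_nonneg(1)[OF elim(2)] by simp
  qed
  ultimately show ?thesis by (rule Lim_null_comparison[rotated])
qed

text \<open>The energy is affine in \<open>k\<close>: it equals
  \<open>(\<alpha> - 1 - k) q + h + \<beta> k (t \<delta> \<phi>)\<close> with \<open>q\<close> and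
  \<open>h\<close> independent of \<open>k\<close>, and the last term vanishes. Two values of
  \<open>k\<close> thus give limits of \<open>q\<close> and \<open>h\<close> separately, although
  neither is known to be monotone.\<close>

lemma kinetic_potential_tendsto:
  "((\<lambda>t. t\<^sup>2 * (norm (p t))\<^sup>2 / 2 + t\<^sup>2 * \<delta> t * \<phi> t) \<longlongrightarrow> 0) at_top"
  (is "(?h \<longlongrightarrow> 0) at_top")
proof -
  obtain z where z: "z \<in> argmin f" using argmin by blast
  \<comment> \<open>Any two distinct values in the admissible range would do; the divisor
    \<open>\<zeta> / 6\<close> below is their difference.\<close>
  have k1: "0 < \<zeta> / 2" "\<zeta> / 2 < \<zeta>" and k2: "0 < \<zeta> / 3" "\<zeta> / 3 < \<zeta>" using \<zeta> by auto
  define q where "q t = (\<alpha> - 1) / 2 * (norm (x t - z))\<^sup>2 + t * inner (x t - z) (p t)" for t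
  have expand: "energy k z t = (\<alpha> - 1 - k) * q t + ?h t + \<beta> * k * (t * \<delta> t * \<phi> t)" for k t
    unfolding energy_def q_def norm_sq_linear_combination by (simp add: power2_eq_square field_simps)
  obtain L1 where L1: "(energy (\<zeta> / 2) z \<longlongrightarrow> L1) at_top" by (rule energy_tendsto[OF k1 z])
  obtain L2 where L2: "(energy (\<zeta> / 3) z \<longlongrightarrow> L2) at_top" by (rule energy_tendsto[OF k2 z])
  have "((\<lambda>t. (energy (\<zeta> / 3) z t - energy (\<zeta> / 2) z t + \<beta> * (\<zeta> / 6) * (t * \<delta> t * \<phi> t)) / (\<zeta> / 6))
      \<longlongrightarrow> (L2 - L1 + \<beta> * (\<zeta> / 6) * 0) / (\<zeta> / 6)) at_top"
    by (intro tendsto_intros L1 L2 \<delta>\<phi>_t_tendsto) (use \<zeta> in auto)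
  moreover have "(energy (\<zeta> / 3) z t - energy (\<zeta> / 2) z t + \<beta> * (\<zeta> / 6) * (t * \<delta> t * \<phi> t)) / (\<zeta> / 6) = q t" for t
    unfolding expand using \<zeta>(1) by (simp add: field_simps)
  ultimately obtain M where M: "(q \<longlongrightarrow> M) at_top" by auto
  have "((\<lambda>t. energy (\<zeta> / 2) z t - (\<alpha> - 1 - \<zeta> / 2) * q t - \<beta> * (\<zeta> / 2) * (t * \<delta> t * \<phi> t))
      \<longlongrightarrow> L1 - (\<alpha> - 1 - \<zeta> / 2) * M - \<beta> * (\<zeta> / 2) * 0) at_top"
    by (intro tendsto_intros L1 M \<delta>\<phi>_t_tendsto)
  then have lim: "(?h \<longlongrightarrow> L1 - (\<alpha> - 1 - \<zeta> / 2) * M) at_top"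
    unfolding expand by simp
  obtain R b where R: "R \<ge> T" "b > 0"
    "\<And>t. t \<ge> R \<Longrightarrow> \<exists>D. (energy (\<zeta> / 2) z has_real_derivative D) (at t) \<and> D \<le> - b * dissipation t"
    by (rule energy_decay[OF k1 z]) blast
  have "L1 - (\<alpha> - 1 - \<zeta> / 2) * M = 0"
  \<comment> \<open>The factor \<open>1 + \<beta>\<^sup>2\<close> comes from
    \<open>p = x' + \<beta> \<delta> g\<close>: half of \<open>|p|^2\<close> is at most
    \<open>|x'|^2 + \<beta>^2 \<delta>^2 |g|^2\<close>, and \<open>t \<le> t ^ 3\<close> fits the
    last term under the dissipation.\<close>
  proof (rule dissipation_limit_zero[OF lim, of R "energy (\<zeta> / 2) z" "b / (1 + \<beta>\<^sup>2)"])
    fix t assume t: "R \<le> t"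
    then have t': "t \<ge> T" "t \<ge> 1" using R(1) T by auto
    show "0 \<le> energy (\<zeta> / 2) z t" by (rule energy_nonneg(3)[OF k1 t'(1)])
    show "0 \<le> ?h t" using \<delta>_pos[OF t'(1)] \<phi>_nonneg[OF t'(1)] by simp
    have "(norm (p t))\<^sup>2 \<le> (norm (x' t) + norm ((\<beta> * \<delta> t) *\<^sub>R g t))\<^sup>2"
      unfolding p[OF t'(1)] by (intro power_mono norm_triangle_ineq) simp
    also have "\<dots> \<le> 2 * (norm (x' t))\<^sup>2 + 2 * (norm ((\<beta> * \<delta> t) *\<^sub>R g t))\<^sup>2"
      using zero_le_power2[of "norm (x' t) - norm ((\<beta> * \<delta> t) *\<^sub>R g t)"]
      by (simp only: power2_sum power2_diff)
    also have "\<dots> = 2 * (norm (x' t))\<^sup>2 + 2 * (\<beta>\<^sup>2 * (\<delta> t)\<^sup>2 * (norm (g t))\<^sup>2)"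
      by (simp add: power_mult_distrib)
    finally have "t * (norm (p t))\<^sup>2 \<le> t * (2 * (norm (x' t))\<^sup>2 + 2 * (\<beta>\<^sup>2 * (\<delta> t)\<^sup>2 * (norm (g t))\<^sup>2))"
      using t' by (intro mult_left_mono) auto
    then have P: "t * (norm (p t))\<^sup>2 / 2 \<le> t * (norm (x' t))\<^sup>2 + \<beta>\<^sup>2 * (t * ((\<delta> t)\<^sup>2 * (norm (g t))\<^sup>2))"
      by (simp add: algebra_simps)
    have "t * ((\<delta> t)\<^sup>2 * (norm (g t))\<^sup>2) \<le> t ^ 3 * ((\<delta> t)\<^sup>2 * (norm (g t))\<^sup>2)"
      using t' power_increasing[of 1 3 t] by (intro mult_right_mono) auto
    then have Q: "\<beta>\<^sup>2 * (t * ((\<delta> t)\<^sup>2 * (norm (g t))\<^sup>2)) \<le> \<beta>\<^sup>2 * (t ^ 3 * (\<delta> t)\<^sup>2 * (norm (g t))\<^sup>2)"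
      by (intro mult_left_mono) (auto simp: mult.assoc)
    have "?h t / t = t * (norm (p t))\<^sup>2 / 2 + t * \<delta> t * \<phi> t"
      using t' by (simp add: power2_eq_square field_simps)
    also have "\<dots> \<le> dissipation t + \<beta>\<^sup>2 * dissipation t"
    proof -
      have "\<beta>\<^sup>2 * (t ^ 3 * (\<delta> t)\<^sup>2 * (norm (g t))\<^sup>2) \<le> \<beta>\<^sup>2 * dissipation t"
        using dissipation_terms_nonneg[OF t'(1)] by (intro mult_left_mono) (auto simp: dissipation_def)
      then show ?thesis using P Q dissipation_terms_nonneg[OF t'(1)] by (simp add: dissipation_def)
    qed
    also have "\<dots> = dissipation t * (1 + \<beta>\<^sup>2)" by (simp add: algebra_simps)
    finally have "?h t / t / (1 + \<beta>\<^sup>2) \<le> dissipation t"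
      by (subst pos_divide_le_eq) (simp_all only: add_pos_nonneg zero_less_one zero_le_power2)
    then have "b * (?h t / t / (1 + \<beta>\<^sup>2)) \<le> b * dissipation t"
      using R(2) by (intro mult_left_mono) auto
    then show "\<exists>D. (energy (\<zeta> / 2) z has_real_derivative D) (at t) \<and> D \<le> - (b / (1 + \<beta>\<^sup>2)) * (?h t / t)"
      using R(3)[OF t] by (force simp: mult.commute)
  qed (use R(2) in \<open>simp add: add_pos_nonneg\<close>)
  then show ?thesis using lim by simp
qed

section \<open>Pointwise rates\<close>

theorem envelope_gap_tendsto: "((\<lambda>t. t\<^sup>2 * \<delta> t * \<phi> t) \<longlongrightarrow> 0) at_top"
proof (rule tendsto_sandwich[OF _ _ tendsto_const kinetic_potential_tendsto])
  show "\<forall>\<^sub>F t in at_top. 0 \<le> t\<^sup>2 * \<delta> t * \<phi> t"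
    using eventually_ge_at_top[of T] by eventually_elim (use \<delta>_pos \<phi>_nonneg in \<open>simp add: less_imp_le\<close>)
qed simp

lemma momentum_tendsto: "((\<lambda>t. t * norm (p t)) \<longlongrightarrow> 0) at_top"
proof -
  have "((\<lambda>t. sqrt (2 * ((t\<^sup>2 * (norm (p t))\<^sup>2 / 2 + t\<^sup>2 * \<delta> t * \<phi> t) - t\<^sup>2 * \<delta> t * \<phi> t))) \<longlongrightarrow> sqrt (2 * (0 - 0))) at_top"
    by (intro tendsto_intros kinetic_potential_tendsto envelope_gap_tendsto)
  moreover have "\<forall>\<^sub>F t in at_top. sqrt (2 * ((t\<^sup>2 * (norm (p t))\<^sup>2 / 2 + t\<^sup>2 * \<delta> t * \<phi> t) - t\<^sup>2 * \<delta> t * \<phi> t)) = t * norm (p t)"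
    using eventually_ge_at_top[of 0] by eventually_elim (simp add: real_sqrt_mult)
  ultimately show ?thesis by (simp add: tendsto_cong)
qed

text \<open>With \<open>a = t^2 \<delta>\<close>, hypothesis (b) in the form
  \<open>a \<le> K \<gamma>\<close> and the bound of \<open>\<gamma> |g|^2 / 2\<close> by the gap
  give \<open>(a |g|)^2 \<le> 2 K a \<phi>\<close>, and \<open>a \<phi>\<close> tends to 0.\<close>

theorem gradient_tendsto: "((\<lambda>t. t\<^sup>2 * \<delta> t * norm (g t)) \<longlongrightarrow> 0) at_top"
proof -
  have "((\<lambda>t. sqrt (2 * K * (t\<^sup>2 * \<delta> t * \<phi> t))) \<longlongrightarrow> sqrt (2 * K * 0)) at_top"
    by (intro tendsto_intros envelope_gap_tendsto)
  then have lim: "((\<lambda>t. sqrt (2 * K * (t\<^sup>2 * \<delta> t * \<phi> t))) \<longlongrightarrow> 0) at_top" by simp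
  have "\<forall>\<^sub>F t in at_top. norm (t\<^sup>2 * \<delta> t * norm (g t)) \<le> sqrt (2 * K * (t\<^sup>2 * \<delta> t * \<phi> t))"
    using eventually_ge_at_top[of T]
  proof eventually_elim
    case (elim t)
    then have t: "t > 0" "\<delta> t > 0" "\<gamma> t > 0" "\<phi> t \<ge> 0" using T \<delta>_pos \<gamma>_pos \<phi>_nonneg by auto
    define a where "a = t\<^sup>2 * \<delta> t"
    have "a > 0" using t by (simp add: a_def)
    have aK: "a \<le> K * \<gamma> t" using \<delta>_le_\<gamma>[OF elim] by (simp add: a_def)
    have "\<gamma> t / 2 * (norm (g t))\<^sup>2 \<le> \<phi> t"
      unfolding \<phi>_def by (rule grad_norm_sq_le[OF t(3)])
    moreover have "K > 0"
      using less_le_trans[OF \<open>a > 0\<close> aK] t(3) by (rule zero_less_mult_pos2)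
    ultimately have "2 * K * (\<gamma> t / 2 * (norm (g t))\<^sup>2) \<le> 2 * K * \<phi> t"
      by (intro mult_left_mono) auto
    moreover have "a * (norm (g t))\<^sup>2 \<le> K * \<gamma> t * (norm (g t))\<^sup>2"
      using aK by (intro mult_right_mono) auto
    ultimately have "a * (norm (g t))\<^sup>2 \<le> 2 * K * \<phi> t" by simp
    then have "a * (a * (norm (g t))\<^sup>2) \<le> a * (2 * K * \<phi> t)"
      using \<open>a > 0\<close> by (intro mult_left_mono) auto
    then have "(a * norm (g t))\<^sup>2 \<le> 2 * K * (a * \<phi> t)"
      by (simp add: power2_eq_square algebra_simps)
    then have "a * norm (g t) \<le> sqrt (2 * K * (a * \<phi> t))"
      by (rule real_le_rsqrt)
    then show ?case using t by (simp add: a_def)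
  qed
  then show ?thesis using lim by (rule Lim_null_comparison)
qed

text \<open>Since \<open>x' = p - \<beta> \<delta> g\<close>, the rates of \<open>p\<close> and of
  the gradient combine; for \<open>t \<ge> 1\<close> the weight \<open>t \<delta>\<close> is at most
  \<open>t^2 \<delta>\<close>.\<close>

theorem velocity_tendsto: "((\<lambda>t. t * norm (x' t)) \<longlongrightarrow> 0) at_top"
proof -
  have "((\<lambda>t. t * norm (p t) + \<beta> * (t\<^sup>2 * \<delta> t * norm (g t))) \<longlongrightarrow> 0 + \<beta> * 0) at_top"
    by (intro tendsto_intros momentum_tendsto gradient_tendsto)
  then have lim: "((\<lambda>t. t * norm (p t) + \<beta> * (t\<^sup>2 * \<delta> t * norm (g t))) \<longlongrightarrow> 0) at_top" by simp
  have "\<forall>\<^sub>F t in at_top. norm (t * norm (x' t)) \<le> t * norm (p t) + \<beta> * (t\<^sup>2 * \<delta> t * norm (g t))"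
    using eventually_ge_at_top[of T]
  proof eventually_elim
    case (elim t)
    then have t: "t \<ge> 1" "\<delta> t > 0" using T \<delta>_pos by auto
    have "norm (x' t) \<le> norm (p t) + norm ((\<beta> * \<delta> t) *\<^sub>R g t)"
      using norm_triangle_ineq4[of "p t" "(\<beta> * \<delta> t) *\<^sub>R g t"] by (simp add: p[OF elim])
    then have "norm (x' t) \<le> norm (p t) + \<beta> * (\<delta> t * norm (g t))"
      using t \<beta> by (simp add: mult.assoc)
    then have "t * norm (x' t) \<le> t * (norm (p t) + \<beta> * (\<delta> t * norm (g t)))"
      using t by (intro mult_left_mono) auto
    also have "\<dots> = t * norm (p t) + \<beta> * (t ^ 1 * (\<delta> t * norm (g t)))"
      by (simp add: algebra_simps)
    also have "\<dots> \<le> t * norm (p t) + \<beta> * (t ^ 2 * (\<delta> t * norm (g t)))"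
      using t \<beta> by (intro add_left_mono mult_left_mono mult_right_mono power_increasing) auto
    finally show ?case using t by (simp add: mult.assoc)
  qed
  then show ?thesis using lim by (rule Lim_null_comparison)
qed

text \<open>The energy converges, and so do all its terms other than the multiple of the squared
  distance: the cross term vanishes because \<open>x - z\<close> is bounded and \<open>t |p|\<close>
  tends to 0. The coefficient \<open>l (\<alpha> - 1) / 2\<close> collects \<open>l^2 / 2\<close>
  and \<open>l k / 2\<close> for \<open>k = \<zeta> / 2\<close>.\<close>

lemma distance_to_argmin_tendsto:
  assumes z: "z \<in> argmin f"
  shows "\<exists>l. ((\<lambda>t. (norm (x t - z))\<^sup>2) \<longlongrightarrow> l) at_top"
proof -
  have k: "0 < \<zeta> / 2" "\<zeta> / 2 < \<zeta>" using \<zeta> by auto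
  define l where "l = \<alpha> - 1 - \<zeta> / 2"
  have "l > 0" using \<zeta> \<alpha> by (simp add: l_def)
  obtain L where L: "(energy (\<zeta> / 2) z \<longlongrightarrow> L) at_top" by (rule energy_tendsto[OF k z])
  obtain B where B: "\<forall>\<^sub>F t in at_top. norm (x t - z) \<le> B"
    by (rule bounded_trajectory[OF z])
  have "((\<lambda>t. B * (t * norm (p t))) \<longlongrightarrow> B * 0) at_top"
    by (intro tendsto_intros momentum_tendsto)
  then have lim: "((\<lambda>t. B * (t * norm (p t))) \<longlongrightarrow> 0) at_top" by simp
  have "\<forall>\<^sub>F t in at_top. norm (t * inner (x t - z) (p t)) \<le> B * (t * norm (p t))"
    using B eventually_ge_at_top[of 0]
  proof eventually_elim
    case (elim t)
    have "\<bar>inner (x t - z) (p t)\<bar> \<le> B * norm (p t)"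
      using Cauchy_Schwarz_ineq2[of "x t - z" "p t"] mult_right_mono[OF elim(1), of "norm (p t)"] by simp
    then show ?case
      using elim(2) mult_left_mono[of "\<bar>inner (x t - z) (p t)\<bar>" "B * norm (p t)" t]
      by (simp add: abs_mult mult.left_commute)
  qed
  then have in0: "((\<lambda>t. t * inner (x t - z) (p t)) \<longlongrightarrow> 0) at_top"
    using lim by (rule Lim_null_comparison)
  have "((\<lambda>t. (energy (\<zeta> / 2) z t - l * (t * inner (x t - z) (p t))
      - (t\<^sup>2 * (norm (p t))\<^sup>2 / 2 + t\<^sup>2 * \<delta> t * \<phi> t) - \<beta> * (\<zeta> / 2) * (t * \<delta> t * \<phi> t)) / (l * (\<alpha> - 1) / 2))
      \<longlongrightarrow> (L - l * 0 - 0 - \<beta> * (\<zeta> / 2) * 0) / (l * (\<alpha> - 1) / 2)) at_top"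
    by (intro tendsto_intros L in0 \<delta>\<phi>_t_tendsto kinetic_potential_tendsto) (use \<open>l > 0\<close> \<alpha> in auto)
  moreover have "energy (\<zeta> / 2) z t - l * (t * inner (x t - z) (p t))
      - (t\<^sup>2 * (norm (p t))\<^sup>2 / 2 + t\<^sup>2 * \<delta> t * \<phi> t) - \<beta> * (\<zeta> / 2) * (t * \<delta> t * \<phi> t)
    = l * (\<alpha> - 1) / 2 * (norm (x t - z))\<^sup>2" for t
  proof -
    have \<alpha>: "\<alpha> - 1 = l + \<zeta> / 2" by (simp add: l_def)
    show ?thesis
      unfolding energy_def l_def[symmetric] norm_sq_linear_combination \<alpha> by (simp add: field_simps power2_eq_square)
  qed
  ultimately show ?thesis using \<open>l > 0\<close> \<alpha> by auto
qed

text \<open>A weak cluster point \<open>w\<close> is tested with \<open>h\<close>, the gradient at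
  \<open>w\<close> of the envelope with fixed parameter 1. The supporting inequality at
  \<open>w\<close>, read at the proximal points \<open>x - \<gamma> g\<close>, is a half-space
  condition on \<open>x t\<close> up to vanishing errors; inserting \<open>w\<close> shows that this
  envelope is minimal at \<open>w\<close>.\<close>

theorem trajectory_weakly_converges:
  assumes m: "m > 0" and le: "\<forall>\<^sub>F t in at_top. m * \<gamma> t \<le> t\<^sup>2 * \<delta> t"
  shows "\<exists>z\<in>argmin f. weakly_tendsto x z at_top"
proof (rule opial_weak_convergence[OF argmin distance_to_argmin_tendsto])
  fix w assume w: "\<And>y c. \<forall>\<^sub>F t in at_top. inner (x t) y \<le> c \<Longrightarrow> inner w y \<le> c"
  define h where "h = grad 1 w"
  \<comment> \<open>The lower bound on \<open>t^2 \<delta> / \<gamma>\<close> enters here: it makes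
    the proximal points asymptotic to the trajectory.\<close>
  have \<gamma>g: "((\<lambda>t. \<gamma> t *\<^sub>R g t) \<longlongrightarrow> 0) at_top"
  proof (rule Lim_null_comparison)
    have "((\<lambda>t. 1 / m * (t\<^sup>2 * \<delta> t * norm (g t))) \<longlongrightarrow> 1 / m * 0) at_top"
      by (intro tendsto_intros gradient_tendsto)
    then show "((\<lambda>t. 1 / m * (t\<^sup>2 * \<delta> t * norm (g t))) \<longlongrightarrow> 0) at_top" by simp
    show "\<forall>\<^sub>F t in at_top. norm (\<gamma> t *\<^sub>R g t) \<le> 1 / m * (t\<^sup>2 * \<delta> t * norm (g t))"
      using le eventually_ge_at_top[of T]
    proof eventually_elim
      case (elim t)
      have "m * \<gamma> t * norm (g t) \<le> t\<^sup>2 * \<delta> t * norm (g t)"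
        using elim(1) by (rule mult_right_mono) simp
      then show ?case using m \<gamma>_pos[OF elim(2)] by (simp add: field_simps)
    qed
  qed
  \<comment> \<open>The rate of the gap is relative to \<open>t^2 \<delta>\<close>; monotonicity of
    \<open>\<delta>\<close> keeps this weight above \<open>\<delta> T\<close>, so the gap itself
    vanishes.\<close>
  have \<delta>_mono: "\<delta> T \<le> \<delta> t" if "T \<le> t" for t
    by (rule DERIV_nonneg_imp_nondecreasing[OF that]) (use \<delta>_deriv \<delta>_growth(1) in blast)
  have \<phi>0: "(\<phi> \<longlongrightarrow> 0) at_top"
  proof (rule Lim_null_comparison)
    have "((\<lambda>t. 1 / \<delta> T * (t\<^sup>2 * \<delta> t * \<phi> t)) \<longlongrightarrow> 1 / \<delta> T * 0) at_top"
      by (intro tendsto_intros envelope_gap_tendsto)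
    then show "((\<lambda>t. 1 / \<delta> T * (t\<^sup>2 * \<delta> t * \<phi> t)) \<longlongrightarrow> 0) at_top" by simp
    show "\<forall>\<^sub>F t in at_top. norm (\<phi> t) \<le> 1 / \<delta> T * (t\<^sup>2 * \<delta> t * \<phi> t)"
      using eventually_ge_at_top[of T]
    proof eventually_elim
      case (elim t)
      have "1 * \<delta> T \<le> t\<^sup>2 * \<delta> t"
        using \<delta>_mono[OF elim] \<delta>_pos[of T] elim T by (intro mult_mono) (auto simp: one_le_power)
      then have "\<delta> T * \<phi> t \<le> t\<^sup>2 * \<delta> t * \<phi> t"
        using \<phi>_nonneg[OF elim] by (intro mult_right_mono) auto
      then show ?case using \<delta>_pos[of T] \<phi>_nonneg[OF elim] by (simp add: field_simps)
    qed
  qed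
  have "((\<lambda>t. inner w h + min_value f - env 1 w + (\<phi> t + inner h (\<gamma> t *\<^sub>R g t)))
      \<longlongrightarrow> inner w h + min_value f - env 1 w + (0 + inner h 0)) at_top"
    by (intro tendsto_intros \<phi>0 \<gamma>g)
  then have lim: "((\<lambda>t. inner w h + min_value f - env 1 w + (\<phi> t + inner h (\<gamma> t *\<^sub>R g t)))
      \<longlongrightarrow> inner w h + min_value f - env 1 w) at_top" by simp
  have bound: "\<forall>\<^sub>F t in at_top. inner (x t) h \<le> inner w h + min_value f - env 1 w + (\<phi> t + inner h (\<gamma> t *\<^sub>R g t))"
    using eventually_ge_at_top[of T]
  proof eventually_elim
    case (elim t)
    define P where "P = x t - \<gamma> t *\<^sub>R g t"
    have "env 1 P \<le> env (\<gamma> t) (x t)"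
      unfolding P_def by (rule env_proximal_point_le[OF \<gamma>_pos[OF elim]]) simp
    moreover have "env 1 w + inner h (P - w) \<le> env 1 P"
    proof -
      have "0 \<le> (norm (h - grad 1 P))\<^sup>2 / 2" by simp
      moreover have "env 1 w + inner h (P - w) + (norm (h - grad 1 P))\<^sup>2 / 2 \<le> env 1 P"
        using env_increment[of 1 1 w P] by (simp add: h_def)
      ultimately show ?thesis by linarith
    qed
    ultimately have "env 1 w + inner h (P - w) \<le> env (\<gamma> t) (x t)" by linarith
    then show ?case
      by (simp add: P_def \<phi>_def inner_diff_right inner_commute)
  qed
  have "env 1 w \<le> min_value f"
  proof (rule field_le_epsilon)
    fix e :: real assume "e > 0"
    have "\<forall>\<^sub>F t in at_top. inner w h + min_value f - env 1 w + (\<phi> t + inner h (\<gamma> t *\<^sub>R g t))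
        < inner w h + min_value f - env 1 w + e"
      by (rule order_tendstoD(2)[OF lim]) (use \<open>e > 0\<close> in simp)
    with bound have "\<forall>\<^sub>F t in at_top. inner (x t) h \<le> inner w h + min_value f - env 1 w + e"
      by eventually_elim linarith
    \<comment> \<open>At \<open>w\<close> the term \<open>inner w h\<close> stands on both sides, so
      only the comparison of values remains.\<close>
    from w[OF this] show "env 1 w \<le> min_value f + e" by linarith
  qed
  then show "w \<in> argmin f" by (rule argmin_envI[rotated]) simp
qed

end

subsection \<open>Solution trajectories\<close>

lemma C1_from_has_vector_derivative_at:
  assumes "C1_from t0 h h'" "t > t0"
  shows "(h has_vector_derivative h' t) (at t)"
proof -
  have "(h has_vector_derivative h' t) (at t within {t0..})"
    using assms by (simp add: C1_from_def)
  then have "(h has_vector_derivative h' t) (at t within {t0<..})"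
    by (rule has_vector_derivative_within_subset) auto
  then show ?thesis using assms(2) by (simp add: at_within_open[of t "{t0<..}"])
qed

lemma C1_from_continuous_on:
  assumes "C1_from t0 h h'"
  shows "continuous_on {t0..} h" "continuous_on {t0..} h'"
  using assms unfolding C1_from_def
  by (auto intro!: continuous_on_vector_derivative[of "{t0..}" h h'])

lemma continuous_on_Icc_norm_bound:
  fixes h :: "real \<Rightarrow> 'b::real_normed_vector"
  assumes "continuous_on {a..} h"
  obtains B where "B > 0" "\<And>t. t \<in> {a..S} \<Longrightarrow> norm (h t) \<le> B"
proof -
  have "compact (h ` {a..S})"
    by (intro compact_continuous_image continuous_on_subset[OF assms]) auto
  then obtain B where "B > 0" "\<forall>y\<in>h ` {a..S}. norm y \<le> B"
    using compact_imp_bounded bounded_pos by blast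
  then show ?thesis using that by blast
qed

lemma C1_from_lipschitz:
  assumes "C1_from t0 h h'"
  obtains L where "L > 0" "\<And>s t. \<lbrakk>s \<in> {t0..S}; t \<in> {t0..S}\<rbrakk> \<Longrightarrow> norm (h t - h s) \<le> L * \<bar>t - s\<bar>"
proof -
  obtain B where B: "B > 0" "\<And>t. t \<in> {t0..S} \<Longrightarrow> norm (h' t) \<le> B"
    using continuous_on_Icc_norm_bound[OF C1_from_continuous_on(2)[OF assms]] by blast
  have "norm (h t - h s) \<le> B * norm (t - s)" if "s \<in> {t0..S}" "t \<in> {t0..S}" for s t
  proof (rule differentiable_bound[of "{t0..S}" h "\<lambda>t r. r *\<^sub>R h' t"])
    fix r assume r: "r \<in> {t0..S}"
    have "(h has_vector_derivative h' r) (at r within {t0..})"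
      using assms r by (simp add: C1_from_def)
    then have "(h has_vector_derivative h' r) (at r within {t0..S})"
      by (rule has_vector_derivative_within_subset) auto
    then show "(h has_derivative (\<lambda>s. s *\<^sub>R h' r)) (at r within {t0..S})"
      by (simp add: has_vector_derivative_def)
    show "onorm (\<lambda>s. s *\<^sub>R h' r) \<le> B"
      using B(2)[OF r] by (intro onorm_bound) (auto simp: mult.commute[of B] B(1) less_imp_le intro!: mult_left_mono)
  qed (use that in auto)
  then show ?thesis using that[of B] B(1) by simp
qed

context moreau
begin

lemma grad_along_continuous_on:
  assumes "C1_from t0 \<gamma> \<gamma>'" "C1_from t0 x x'" "\<And>t. t \<ge> t0 \<Longrightarrow> \<gamma> t > 0"
  shows "continuous_on {t0..} (\<lambda>t. grad (\<gamma> t) (x t))"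
  unfolding continuous_on_def
proof
  fix t assume t: "t \<in> {t0..}"
  show "((\<lambda>t. grad (\<gamma> t) (x t)) \<longlongrightarrow> grad (\<gamma> t) (x t)) (at t within {t0..})"
    using C1_from_continuous_on(1)[OF assms(1)] C1_from_continuous_on(1)[OF assms(2)] t assms(3)
    by (intro tendsto_grad) (auto simp: continuous_on_def)
qed

text \<open>On a compact interval \<open>\<gamma>\<close> has a positive lower bound
  \<open>m\<close>, which makes the gradient Lipschitz in parameter and point together; the factor
  \<open>\<delta>\<close> adds its own variation. This regularity carries absolute continuity over
  from \<open>x'\<close> to \<open>p\<close>.\<close>

lemma scaled_grad_lipschitz:
  assumes \<delta>: "C1_from t0 \<delta> \<delta>'" and \<gamma>: "C1_from t0 \<gamma> \<gamma>'" and x: "C1_from t0 x x'"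
    and pos: "\<And>t. t \<ge> t0 \<Longrightarrow> \<gamma> t > 0" and "t0 \<le> S"
  obtains L where "L > 0" "\<And>s t. \<lbrakk>s \<in> {t0..S}; t \<in> {t0..S}\<rbrakk> \<Longrightarrow>
    norm (\<delta> t *\<^sub>R grad (\<gamma> t) (x t) - \<delta> s *\<^sub>R grad (\<gamma> s) (x s)) \<le> L * \<bar>t - s\<bar>"
proof -
  define g where "g t = grad (\<gamma> t) (x t)" for t
  obtain M where M: "M > 0" "\<And>t. t \<in> {t0..S} \<Longrightarrow> norm (g t) \<le> M"
    using continuous_on_Icc_norm_bound[OF grad_along_continuous_on[OF \<gamma> x pos]] unfolding g_def by blast
  obtain N where N: "N > 0" "\<And>t. t \<in> {t0..S} \<Longrightarrow> norm (\<delta> t) \<le> N"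
    using continuous_on_Icc_norm_bound[OF C1_from_continuous_on(1)[OF \<delta>]] by blast
  obtain L1 where L1: "L1 > 0" "\<And>s t. \<lbrakk>s \<in> {t0..S}; t \<in> {t0..S}\<rbrakk> \<Longrightarrow> norm (\<delta> t - \<delta> s) \<le> L1 * \<bar>t - s\<bar>"
    using C1_from_lipschitz[OF \<delta>] by blast
  obtain L2 where L2: "L2 > 0" "\<And>s t. \<lbrakk>s \<in> {t0..S}; t \<in> {t0..S}\<rbrakk> \<Longrightarrow> norm (\<gamma> t - \<gamma> s) \<le> L2 * \<bar>t - s\<bar>"
    using C1_from_lipschitz[OF \<gamma>] by blast
  obtain L3 where L3: "L3 > 0" "\<And>s t. \<lbrakk>s \<in> {t0..S}; t \<in> {t0..S}\<rbrakk> \<Longrightarrow> norm (x t - x s) \<le> L3 * \<bar>t - s\<bar>"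
    using C1_from_lipschitz[OF x] by blast
  have "\<exists>r\<in>{t0..S}. \<forall>t\<in>{t0..S}. \<gamma> r \<le> \<gamma> t"
    using \<open>t0 \<le> S\<close> by (intro continuous_attains_inf continuous_on_subset[OF C1_from_continuous_on(1)[OF \<gamma>]]) auto
  then obtain m where m: "m > 0" "\<And>t. t \<in> {t0..S} \<Longrightarrow> m \<le> \<gamma> t"
    using pos by (metis atLeastAtMost_iff)
  show ?thesis
  proof (rule that[of "N * ((L3 + L2 * M) / m) + L1 * M"])
    show "0 < N * ((L3 + L2 * M) / m) + L1 * M"
      using M(1) N(1) L1(1) L2(1) L3(1) m(1) by (intro add_pos_pos mult_pos_pos divide_pos_pos)
    fix s t assume st: "s \<in> {t0..S}" "t \<in> {t0..S}"
    have "m * norm (g t - g s) \<le> min (\<gamma> s) (\<gamma> t) * norm (g t - g s)"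
      using m(2)[OF st(1)] m(2)[OF st(2)] by (intro mult_right_mono) auto
    also have "\<dots> \<le> norm (x t - x s) + \<bar>\<gamma> t - \<gamma> s\<bar> * norm (g s)"
      unfolding g_def using st pos by (intro grad_dist_le) auto
    also have "\<dots> \<le> L3 * \<bar>t - s\<bar> + L2 * \<bar>t - s\<bar> * M"
      using L2(2)[OF st] L3(2)[OF st] M(2)[OF st(1)] L2(1) by (intro add_mono mult_mono) auto
    finally have g: "norm (g t - g s) \<le> (L3 + L2 * M) / m * \<bar>t - s\<bar>"
      using m(1) by (simp add: field_simps)
    have "norm (\<delta> t *\<^sub>R g t - \<delta> s *\<^sub>R g s) = norm (\<delta> t *\<^sub>R (g t - g s) + (\<delta> t - \<delta> s) *\<^sub>R g s)"
      by (simp add: algebra_simps)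
    also have "\<dots> \<le> \<bar>\<delta> t\<bar> * norm (g t - g s) + \<bar>\<delta> t - \<delta> s\<bar> * norm (g s)"
      using norm_triangle_ineq[of "\<delta> t *\<^sub>R (g t - g s)" "(\<delta> t - \<delta> s) *\<^sub>R g s"] by simp
    also have "\<dots> \<le> N * ((L3 + L2 * M) / m * \<bar>t - s\<bar>) + L1 * \<bar>t - s\<bar> * M"
      using N(2)[OF st(2)] N(1) L1(2)[OF st] L1(1) M(2)[OF st(1)] g
      by (intro add_mono mult_mono) auto
    finally show "norm (\<delta> t *\<^sub>R grad (\<gamma> t) (x t) - \<delta> s *\<^sub>R grad (\<gamma> s) (x s)) \<le>
        (N * ((L3 + L2 * M) / m) + L1 * M) * \<bar>t - s\<bar>"
      unfolding g_def by (simp add: algebra_simps)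
  qed
qed

text \<open>Although neither \<open>x'\<close> nor the gradient term need be differentiable, the combination below is
  \<open>C\<^sup>1\<close>, so that the Lyapunov functions are differentiable everywhere.\<close>

lemma momentum_has_vector_derivative:
  assumes sol: "solution_trajectory f \<alpha> \<beta> \<delta> \<gamma> t0 x x'" and "\<beta> > 0" "t0 > 0"
    and \<delta>: "C1_from t0 \<delta> \<delta>'" and \<gamma>: "C1_from t0 \<gamma> \<gamma>'" and pos: "\<And>t. t \<ge> t0 \<Longrightarrow> \<gamma> t > 0"
    and "t > t0"
  shows "((\<lambda>t. x' t + (\<beta> * \<delta> t) *\<^sub>R grad (\<gamma> t) (x t)) has_vector_derivative
    - ((\<alpha> / t) *\<^sub>R x' t + ((1 + \<beta> / t) * \<delta> t) *\<^sub>R grad (\<gamma> t) (x t))) (at t)"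
proof -
  define g where "g t = grad (\<gamma> t) (x t)" for t
  define p where "p t = x' t + (\<beta> * \<delta> t) *\<^sub>R g t" for t
  define k where "k t = - ((\<alpha> / t) *\<^sub>R x' t + ((1 + \<beta> / t) * \<delta> t) *\<^sub>R g t)" for t
  have x: "C1_from t0 x x'" and ac: "locally_abs_continuous_from t0 x'"
    using sol by (auto simp: solution_trajectory_def)
  have cont: "continuous_on {t0..} k"
    unfolding k_def using \<open>t0 > 0\<close>
    by (intro continuous_intros C1_from_continuous_on[OF x] C1_from_continuous_on[OF \<delta>]
        grad_along_continuous_on[OF \<gamma> x pos, folded g_def]) auto
  \<comment> \<open>The equation supplies the derivative of \<open>p\<close> almost everywhere;
    absolute continuity turns it into an integral identity with a continuous integrand.\<close>
  have int: "(k has_integral (p S - p t0)) {t0..S}" if "t0 \<le> S" for S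
  proof (rule fundamental_theorem_of_calculus_abs_continuous[OF that])
    obtain L where L: "L > 0" "\<And>s t. \<lbrakk>s \<in> {t0..S}; t \<in> {t0..S}\<rbrakk> \<Longrightarrow>
        norm (\<delta> t *\<^sub>R g t - \<delta> s *\<^sub>R g s) \<le> L * \<bar>t - s\<bar>"
      using scaled_grad_lipschitz[OF \<delta> \<gamma> x pos \<open>t0 \<le> S\<close>] unfolding g_def by blast
    show "abs_continuous_on_interval t0 S p"
    proof (rule abs_continuous_on_interval_dominated)
      show "abs_continuous_on_interval t0 S x'"
        using ac that by (simp add: locally_abs_continuous_from_def)
      fix s t assume "t0 \<le> s" "s \<le> t" "t \<le> S"
      then have "\<beta> * norm (\<delta> t *\<^sub>R g t - \<delta> s *\<^sub>R g s) \<le> \<beta> * (L * \<bar>t - s\<bar>)"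
        using \<open>\<beta> > 0\<close> by (intro mult_left_mono L(2)) auto
      moreover have "p t - p s = (x' t - x' s) + \<beta> *\<^sub>R (\<delta> t *\<^sub>R g t - \<delta> s *\<^sub>R g s)"
        by (simp add: p_def algebra_simps)
      then have "norm (p t - p s) = norm ((x' t - x' s) + \<beta> *\<^sub>R (\<delta> t *\<^sub>R g t - \<delta> s *\<^sub>R g s))"
        by (rule arg_cong)
      moreover have "norm (\<beta> *\<^sub>R (\<delta> t *\<^sub>R g t - \<delta> s *\<^sub>R g s)) = \<beta> * norm (\<delta> t *\<^sub>R g t - \<delta> s *\<^sub>R g s)"
        using \<open>\<beta> > 0\<close> by simp
      ultimately have "norm (p t - p s) \<le> norm (x' t - x' s) + \<beta> * (L * \<bar>t - s\<bar>)"
        using norm_triangle_ineq[of "x' t - x' s" "\<beta> *\<^sub>R (\<delta> t *\<^sub>R g t - \<delta> s *\<^sub>R g s)"] by linarith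
      then show "norm (p t - p s) \<le> norm (x' t - x' s) + \<beta> * L * (t - s)"
        using \<open>s \<le> t\<close> by (simp add: mult.assoc)
    qed
    have "AE t in lborel. t \<ge> t0 \<longrightarrow> (\<exists>x'' w. (x' has_vector_derivative x'') (at t within {t0..}) \<and>
           ((\<lambda>s. \<delta> s *\<^sub>R g s) has_vector_derivative w) (at t within {t0..}) \<and>
           x'' + (\<alpha> / t) *\<^sub>R x' t + \<beta> *\<^sub>R w + ((1 + \<beta> / t) * \<delta> t) *\<^sub>R g t = 0)"
      using sol unfolding solution_trajectory_def g_def by blast
    then show "AE t in lborel. t \<in> {t0..S} \<longrightarrow> (p has_vector_derivative k t) (at t within {t0..S})"
    proof eventually_elim
      case (elim t)
      show ?case
      proof
        assume t: "t \<in> {t0..S}"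
        then obtain x'' w where xw: "(x' has_vector_derivative x'') (at t within {t0..})"
           "((\<lambda>s. \<delta> s *\<^sub>R g s) has_vector_derivative w) (at t within {t0..})"
           "x'' + (\<alpha> / t) *\<^sub>R x' t + \<beta> *\<^sub>R w + ((1 + \<beta> / t) * \<delta> t) *\<^sub>R g t = 0"
          using elim by auto
        have "((\<lambda>s. x' s + \<beta> *\<^sub>R (\<delta> s *\<^sub>R g s)) has_vector_derivative x'' + \<beta> *\<^sub>R w) (at t within {t0..})"
          by (intro has_vector_derivative_add xw(1)
              bounded_linear.has_vector_derivative[OF bounded_linear_scaleR_right] xw(2))
        moreover have "x'' + \<beta> *\<^sub>R w = k t"
        proof -
          have "x'' + \<beta> *\<^sub>R w = x'' + (\<alpha> / t) *\<^sub>R x' t + \<beta> *\<^sub>R w + ((1 + \<beta> / t) * \<delta> t) *\<^sub>R g t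
              - ((\<alpha> / t) *\<^sub>R x' t + ((1 + \<beta> / t) * \<delta> t) *\<^sub>R g t)"
            by simp
          then show ?thesis unfolding xw(3) k_def by simp
        qed
        ultimately have "(p has_vector_derivative k t) (at t within {t0..})"
          by (simp add: p_def[abs_def])
        then show "(p has_vector_derivative k t) (at t within {t0..S})"
          by (rule has_vector_derivative_within_subset) auto
      qed
    qed
  qed
  \<comment> \<open>The interval reaches beyond \<open>t\<close>, so the derivative within it is the
    two-sided one.\<close>
  have "((\<lambda>u. integral {t0..u} k) has_vector_derivative k t) (at t within {t0..t + 1})"
    using \<open>t > t0\<close> by (intro integral_has_vector_derivative continuous_on_subset[OF cont]) auto
  then have "((\<lambda>u. p t0 + integral {t0..u} k) has_vector_derivative 0 + k t) (at t within {t0..t + 1})"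
    by (intro has_vector_derivative_add has_vector_derivative_const)
  then have "(p has_vector_derivative 0 + k t) (at t within {t0..t + 1})"
  proof (rule has_vector_derivative_transform[rotated 2])
    show "p u = p t0 + integral {t0..u} k" if "u \<in> {t0..t + 1}" for u
      using int[of u] that by (simp add: integral_unique)
  qed (use \<open>t > t0\<close> in auto)
  then have "(p has_vector_derivative k t) (at t)"
    using \<open>t > t0\<close> by (simp add: at_within_Icc_at)
  then show ?thesis unfolding p_def k_def g_def .
qed

end

theorem theorem3p1:
  fixes f :: "'a::{real_inner, banach} \<Rightarrow> ereal"
    and \<alpha> \<beta> t0 :: real
    and \<delta> \<delta>' \<gamma> \<gamma>' :: "real \<Rightarrow> real"
    and x x' :: "real \<Rightarrow> 'a"
  assumes "proper f" and "convex_ereal f" and "lower_semicontinuous f" and "argmin f \<noteq> {}"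
    and "\<alpha> > 3" and "\<beta> > 0" and "t0 > 0"
    and "\<And>t. t \<ge> t0 \<Longrightarrow> \<delta> t > 0" and "\<And>t. t \<ge> t0 \<Longrightarrow> \<gamma> t > 0"
    and "C1_from t0 \<delta> \<delta>'" and "C1_from t0 \<gamma> \<gamma>'"
    and a: "Liminf at_top (\<lambda>t. ereal (\<gamma>' t / (t * \<delta> t))) > 0"
    and b: "(\<lambda>t. t * \<delta> t / \<gamma> t) \<in> O[at_top](\<lambda>t. 1 / t)"
    and c: "(\<lambda>t. \<gamma>' t / \<gamma> t) \<in> O[at_top](\<lambda>t. 1 / t)"
    and d: "\<exists>\<zeta>. 0 < \<zeta> \<and> \<zeta> \<le> \<alpha> - 3 \<and>
              (\<forall>\<^sub>F t in at_top. 0 \<le> t * \<delta>' t / \<delta> t \<and> t * \<delta>' t / \<delta> t \<le> \<alpha> - 3 - \<zeta>)"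
    and "solution_trajectory f \<alpha> \<beta> \<delta> \<gamma> t0 x x'"
  shows
    "(\<lambda>t. moreau_envelope f (\<gamma> t) (x t) - min_value f) \<in> o[at_top](\<lambda>t. 1 / (t\<^sup>2 * \<delta> t)) \<and>
     (\<lambda>t. norm (gradient (moreau_envelope f (\<gamma> t)) (x t))) \<in> o[at_top](\<lambda>t. 1 / (t\<^sup>2 * \<delta> t)) \<and>
     (\<lambda>t. norm (x' t)) \<in> o[at_top](\<lambda>t. 1 / t) \<and>
     set_integrable lborel {t0..} (\<lambda>t. t * (norm (x' t))\<^sup>2) \<and>
     set_integrable lborel {t0..}
       (\<lambda>t. t ^ 3 * (\<delta> t)\<^sup>2 * (norm (gradient (moreau_envelope f (\<gamma> t)) (x t)))\<^sup>2) \<and>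
     (Liminf at_top (\<lambda>t. ereal (t\<^sup>2 * \<delta> t / \<gamma> t)) > 0 \<longrightarrow>
        (\<exists>z \<in> argmin f. weakly_tendsto x z at_top))"
proof -
  note \<delta>pos = assms(8) and \<gamma>pos = assms(9) and \<delta>C = assms(10) and \<gamma>C = assms(11)
  interpret moreau f by unfold_locales (fact assms)+
  have liminf_pos: "\<exists>m>0. \<forall>\<^sub>F t in at_top. m < h t" if "Liminf at_top (\<lambda>t. ereal (h t)) > 0" for h :: "real \<Rightarrow> real"
  proof -
    obtain m where "0 < ereal m" "ereal m < Liminf at_top (\<lambda>t. ereal (h t))"
      using ereal_dense2[OF \<open>Liminf at_top (\<lambda>t. ereal (h t)) > 0\<close>] by blast
    moreover from less_LiminfD[OF this(2)] have "\<forall>\<^sub>F t in at_top. m < h t" by simp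
    ultimately show ?thesis by auto
  qed
  obtain C where C: "C > 0" "\<forall>\<^sub>F t in at_top. C < \<gamma>' t / (t * \<delta> t)"
    using liminf_pos[OF a] by blast
  obtain K where K: "\<forall>\<^sub>F t in at_top. norm (t * \<delta> t / \<gamma> t) \<le> K * norm (1 / t)"
    using b by (rule landau_o.bigE)
  obtain \<zeta> where \<zeta>: "0 < \<zeta>" "\<zeta> \<le> \<alpha> - 3"
    "\<forall>\<^sub>F t in at_top. 0 \<le> t * \<delta>' t / \<delta> t \<and> t * \<delta>' t / \<delta> t \<le> \<alpha> - 3 - \<zeta>"
    using d by blast
  have "\<forall>\<^sub>F t in at_top. t \<ge> 1 \<and> t > t0 \<and> C < \<gamma>' t / (t * \<delta> t) \<and> norm (t * \<delta> t / \<gamma> t) \<le> K * norm (1 / t)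
      \<and> 0 \<le> t * \<delta>' t / \<delta> t \<and> t * \<delta>' t / \<delta> t \<le> \<alpha> - 3 - \<zeta>"
    using C(2) K \<zeta>(3) eventually_ge_at_top[of 1] eventually_gt_at_top[of t0]
    by eventually_elim simp
  \<comment> \<open>One time after which all conditions at infinity hold; \<open>t > t0\<close>
    makes the derivatives two-sided.\<close>
  then obtain T where late: "\<And>t. t \<ge> T \<Longrightarrow> t \<ge> 1" "\<And>t. t \<ge> T \<Longrightarrow> t > t0" 
    "\<And>t. t \<ge> T \<Longrightarrow> C < \<gamma>' t / (t * \<delta> t)"
    "\<And>t. t \<ge> T \<Longrightarrow> norm (t * \<delta> t / \<gamma> t) \<le> K * norm (1 / t)"
    "\<And>t. t \<ge> T \<Longrightarrow> 0 \<le> t * \<delta>' t / \<delta> t" "\<And>t. t \<ge> T \<Longrightarrow> t * \<delta>' t / \<delta> t \<le> \<alpha> - 3 - \<zeta>"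
    by (auto simp: eventually_at_top_linorder)
  have xC: "C1_from t0 x x'" using assms(16) by (simp add: solution_trajectory_def)
  define p where "p t = x' t + (\<beta> * \<delta> t) *\<^sub>R grad (\<gamma> t) (x t)" for t
  have pos: "\<delta> t > 0" "\<gamma> t > 0" "t > 0" if "t \<ge> T" for t
    using \<delta>pos \<gamma>pos late(1,2)[OF that] by auto
  interpret inertial_trajectory f \<alpha> \<beta> \<delta> \<delta>' \<gamma> \<gamma>' x x' p T \<zeta> C K
  proof
    show "\<alpha> > 3" "\<beta> > 0" "T \<ge> 1" "0 < \<zeta>" "\<zeta> \<le> \<alpha> - 3" "C > 0"
      using assms late(1)[of T] \<zeta> C by auto
  next
    fix t assume t: "t \<ge> T"
    show "\<delta> t > 0" "\<gamma> t > 0" using pos[OF t] by auto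
    show "(\<delta> has_real_derivative \<delta>' t) (at t)" "(\<gamma> has_real_derivative \<gamma>' t) (at t)"
      "(x has_vector_derivative x' t) (at t)"
      using C1_from_has_vector_derivative_at[OF \<delta>C late(2)[OF t]] C1_from_has_vector_derivative_at[OF \<gamma>C late(2)[OF t]]
        C1_from_has_vector_derivative_at[OF xC late(2)[OF t]]
      by (simp_all add: has_real_derivative_iff_has_vector_derivative)
    show "p t = x' t + (\<beta> * \<delta> t) *\<^sub>R grad (\<gamma> t) (x t)" by (rule p_def)
    show "(p has_vector_derivative - ((\<alpha> / t) *\<^sub>R x' t + ((1 + \<beta> / t) * \<delta> t) *\<^sub>R grad (\<gamma> t) (x t))) (at t)"
      unfolding p_def[abs_def]
      using momentum_has_vector_derivative[OF assms(16,6,7) \<delta>C \<gamma>C \<gamma>pos late(2)[OF t]] .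
    show "0 \<le> \<delta>' t" "t * \<delta>' t \<le> (\<alpha> - 3 - \<zeta>) * \<delta> t"
      using late(5,6)[OF t] pos[OF t] by (simp_all add: zero_le_divide_iff zero_le_mult_iff pos_divide_le_eq)
    show "C * (t * \<delta> t) \<le> \<gamma>' t"
      using late(3)[OF t] pos[OF t] by (simp add: pos_less_divide_eq less_imp_le)
    have "t * \<delta> t / \<gamma> t \<le> K / t" using late(4)[OF t] pos[OF t] by simp
    then show "t\<^sup>2 * \<delta> t \<le> K * \<gamma> t"
      using pos[OF t] by (simp add: field_simps power2_eq_square)
  qed
  have smalloI: "h \<in> o[at_top](\<lambda>t. 1 / r t)" if "((\<lambda>t. r t * h t) \<longlongrightarrow> 0) at_top" "\<And>t. t \<ge> T \<Longrightarrow> r t > 0"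
    for h r :: "real \<Rightarrow> real"
  proof (rule smalloI_tendsto)
    show "((\<lambda>t. h t / (1 / r t)) \<longlongrightarrow> 0) at_top" using that(1) by (simp add: mult.commute)
    show "\<forall>\<^sub>F t in at_top. 1 / r t \<noteq> 0"
      using eventually_ge_at_top[of T] by eventually_elim (use that(2) in force)
  qed
  have sq_pos: "t\<^sup>2 * \<delta> t > 0" if "t \<ge> T" for t using pos[OF that] by simp
  obtain z where z: "z \<in> argmin f" using assms(4) by blast
  have k: "0 < \<zeta> / 2" "\<zeta> / 2 < \<zeta>" using \<zeta>(1) by auto
  obtain R B where R: "R \<ge> T" "B > 0"
    "\<And>t. t \<ge> R \<Longrightarrow> \<exists>D. (energy (\<zeta> / 2) z has_real_derivative D) (at t) \<and> D \<le> - B * dissipation t"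
    by (rule energy_decay[OF k z]) blast
  \<comment> \<open>Each integral claim concerns one term of the dissipation, so besides continuity
    and sign only domination by the whole dissipation is asked of \<open>h\<close>.\<close>
  have integrable: "set_integrable lborel {t0..} h"
    if "continuous_on {t0..} h" "\<And>t. t \<ge> t0 \<Longrightarrow> 0 \<le> h t" "\<And>t. t \<ge> T \<Longrightarrow> h t \<le> dissipation t"
    for h :: "real \<Rightarrow> real"
  proof (rule set_integrable_dissipation[OF that(1,2), of R "energy (\<zeta> / 2) z" B])
    show "t0 \<le> R" using late(2)[OF R(1)] by simp
    fix t assume t: "R \<le> t"
    then have t': "T \<le> t" using R(1) by simp
    show "0 \<le> energy (\<zeta> / 2) z t" by (rule energy_nonneg(3)[OF k t'])
    have "B * h t \<le> B * dissipation t" using R(2) that(3)[OF t'] by (intro mult_left_mono) auto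
    then show "\<exists>D. (energy (\<zeta> / 2) z has_real_derivative D) (at t) \<and> D \<le> - B * h t"
      using R(3)[OF t] by force
  qed (use R(2) in auto)
  have "(\<lambda>t. env (\<gamma> t) (x t) - min_value f) \<in> o[at_top](\<lambda>t. 1 / (t\<^sup>2 * \<delta> t))"
    using smalloI[OF envelope_gap_tendsto sq_pos] by (simp add: \<phi>_def)
  moreover have "(\<lambda>t. norm (g t)) \<in> o[at_top](\<lambda>t. 1 / (t\<^sup>2 * \<delta> t))"
    by (rule smalloI[OF gradient_tendsto sq_pos])
  moreover have "(\<lambda>t. norm (x' t)) \<in> o[at_top](\<lambda>t. 1 / t)"
    by (rule smalloI[OF velocity_tendsto pos(3)])
  moreover have "set_integrable lborel {t0..} (\<lambda>t. t * (norm (x' t))\<^sup>2)"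
  proof (rule integrable)
    show "continuous_on {t0..} (\<lambda>t. t * (norm (x' t))\<^sup>2)"
      by (intro continuous_intros C1_from_continuous_on[OF xC])
    show "0 \<le> t * (norm (x' t))\<^sup>2" if "t \<ge> t0" for t using that assms(7) by simp
    show "t * (norm (x' t))\<^sup>2 \<le> dissipation t" if "t \<ge> T" for t
      using dissipation_terms_nonneg[OF that] by (simp add: dissipation_def)
  qed
  moreover have "set_integrable lborel {t0..} (\<lambda>t. t ^ 3 * (\<delta> t)\<^sup>2 * (norm (g t))\<^sup>2)"
  proof (rule integrable)
    show "continuous_on {t0..} (\<lambda>t. t ^ 3 * (\<delta> t)\<^sup>2 * (norm (g t))\<^sup>2)"
      by (intro continuous_intros C1_from_continuous_on[OF \<delta>C] grad_along_continuous_on[OF \<gamma>C xC \<gamma>pos])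
    show "0 \<le> t ^ 3 * (\<delta> t)\<^sup>2 * (norm (g t))\<^sup>2" if "t \<ge> t0" for t using that assms(7) by simp
    show "t ^ 3 * (\<delta> t)\<^sup>2 * (norm (g t))\<^sup>2 \<le> dissipation t" if "t \<ge> T" for t
      using dissipation_terms_nonneg[OF that] by (simp add: dissipation_def)
  qed
  moreover have "\<exists>z\<in>argmin f. weakly_tendsto x z at_top"
    if "Liminf at_top (\<lambda>t. ereal (t\<^sup>2 * \<delta> t / \<gamma> t)) > 0"
  proof -
    obtain m where m: "m > 0" "\<forall>\<^sub>F t in at_top. m < t\<^sup>2 * \<delta> t / \<gamma> t"
      using liminf_pos[OF \<open>Liminf at_top (\<lambda>t. ereal (t\<^sup>2 * \<delta> t / \<gamma> t)) > 0\<close>] by blast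
    have "\<forall>\<^sub>F t in at_top. m * \<gamma> t \<le> t\<^sup>2 * \<delta> t"
      using m(2) eventually_ge_at_top[of T]
      by eventually_elim (use pos(2) in \<open>simp add: pos_less_divide_eq less_imp_le\<close>)
    then show ?thesis by (rule trajectory_weakly_converges[OF m(1)])
  qed
  ultimately show ?thesis by blast
qed

end
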